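(* Let $S$ be a clustering instance and let $D_\rho$ be an interpolated merge function with parameter $\rho\in\blacktriangle^d$ (as in the context). Let $P\subseteq\blacktriangle^d$ be a convex polytope, and suppose that at the current stage of the linkage procedure there are $n_t$ unmerged clusters $C_1,\dots,C_{n_t}$. Write $D_\rho(i,j)=D_\rho(C_i,C_j;\delta)$, and for $i,j\in[n_t]$ let $$Q_{i,j}=\{\rho\in P : D_\rho(i,j)\le D_\rho(i',j')\text{ for all } i',j'\in[n_t]\}.$$ Let $G_P=(V_P,E_P)$ be the region adjacency graph of $P$ and $V_P^*=\{(i,j)\in V_P : Q_{i,j}\neq\emptyset\}$. Suppose $|E_P|=E$ and $|V_P^*|=V$. Then the set $V_P^*$ can be computed in time $O(n_t^2\cdot \mathrm{LP}(d,E)+V\cdot n_t^2K)$, where $K$ is the time it takes to compute the merge function value $D_\rho(i,j)$ and $\mathrm{LP}(d,E)$ is the cost of solving a linear program with $d$ variables and $E$ constraints.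
   Context: A clustering instance is a finite point set $S$ from a data domain $\mathcal{X}$. A linkage-based clustering algorithm starts with all points as singleton clusters and repeatedly merges the pair of current clusters minimizing a merge function $D(A,B)$ (a real-valued function of a pair of clusters), producing a cluster tree. Let $\Delta=\{D_1,\dots,D_l\}$ be a finite family of merge functions, where $D_i(A,B;d')$ depends on a distance metric $d'$, and let $\delta=\{d_1,\dots,d_m\}$ be a finite family of metrics on $\mathcal{X}$. Set $d=lm-1$, index the $lm$ pairs $(i,j)\in[l]\times[m]$ by $1,\dots,d+1$, and let $\blacktriangle^d=\{\rho\in(\mathbb{R}_{\ge0})^d:\sum_i\rho_i\le1\}$. For $\rho\in\blacktriangle^d$ define $\alpha^{(\rho)}\in\mathbb{R}^{d+1}$ by $\alpha^{(\rho)}_k=\rho_k$ for $k\le d$ and $\alpha^{(\rho)}_{d+1}=1-\sum_{k\le d}\rho_k$, and the interpolated merge function $D_\rho(A,B;\delta)=\sum_{i\in[l],j\in[m]}\alpha^{(\rho)}_{i,j}D_i(A,B;d_j)$; this is affine in $\rho$ for fixed $A,B$. The region adjacency graph $G_P=(V_P,E_P)$ has vertex set $V_P=\{(i,j):1\le i<j\le n_t\}$, and an edge between $(i,j)$ and $(i',j')$ iff $Q_{i,j}\cap Q_{i',j'}\neq\emptyset$.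
   Formalization: In Q_{i,j} the competitors i',j' are distinct (D(C,C)=0 could empty all Q, making the bound fail); merge functions are symmetric; LP(d,E) counts constraints beyond ρ∈P, is monotone in E and at least (d+1)(E+1); K is the time to evaluate the defining sum from its base values. *)

theory Defs
  imports "HOL-Analysis.Analysis"
begin

text \<open>
  All indices are 0-based: \<open>[n]\<close> is \<open>{..<n}\<close>. Since the dimension \<open>d\<close> has to be a number (one
  algorithm serves all \<open>d\<close>), a point of real \<open>d\<close>-space is a function \<open>nat \<Rightarrow> real\<close> vanishing on
  \<open>{d..}\<close>.
\<close>

definition std_simplex :: "nat \<Rightarrow> (nat \<Rightarrow> real) set" where
  "std_simplex d = {\<rho>. (\<forall>k<d. 0 \<le> \<rho> k) \<and> (\<forall>k\<ge>d. \<rho> k = 0) \<and> (\<Sum>k<d. \<rho> k) \<le> 1}"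

text \<open>Convex hull of a finite set, as \<open>polytope\<close> in HOL-Analysis.\<close>

definition convex_polytope :: "nat \<Rightarrow> (nat \<Rightarrow> real) set \<Rightarrow> bool" where
  "convex_polytope d P \<longleftrightarrow>
     (\<exists>W. finite W \<and> (\<forall>w\<in>W. \<forall>k\<ge>d. w k = 0) \<and>
          P = {(\<lambda>k. \<Sum>w\<in>W. u w * w k) | u. (\<forall>w\<in>W. 0 \<le> u w) \<and> sum u W = 1})"


section \<open>Interpolated merge functions and linkage\<close>

type_synonym 'x metric = "'x \<Rightarrow> 'x \<Rightarrow> real"
type_synonym 'x merge_fun = "'x set \<Rightarrow> 'x set \<Rightarrow> 'x metric \<Rightarrow> real"

text \<open>A merge function is a function of an unordered pair of clusters.\<close>

definition merge_function :: "'x set \<Rightarrow> 'x merge_fun \<Rightarrow> bool" where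
  "merge_function X D \<longleftrightarrow>
     (\<forall>d' A B. Metric_space X d' \<and> A \<subseteq> X \<and> B \<subseteq> X \<and> finite A \<and> finite B \<and> A \<noteq> {} \<and> B \<noteq> {}
        \<longrightarrow> D A B d' = D B A d')"

definition alpha :: "nat \<Rightarrow> (nat \<Rightarrow> real) \<Rightarrow> nat \<Rightarrow> real" where
  "alpha d \<rho> k = (if k < d then \<rho> k else 1 - (\<Sum>k<d. \<rho> k))"

text \<open>The pair \<open>(i, j)\<close> with \<open>i < l\<close>, \<open>j < m\<close> has index \<open>i * m + j\<close>, so the last index is \<open>d = l * m - 1\<close>.\<close>

definition interp ::
  "nat \<Rightarrow> nat \<Rightarrow> (nat \<Rightarrow> 'x merge_fun) \<Rightarrow> (nat \<Rightarrow> 'x metric) \<Rightarrow> (nat \<Rightarrow> real) \<Rightarrow> 'x set \<Rightarrow> 'x set \<Rightarrow> real"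
  where
  "interp l m D \<delta> \<rho> A B = (\<Sum>i<l. \<Sum>j<m. alpha (l * m - 1) \<rho> (i * m + j) * D i A B (\<delta> j))"

text \<open>Sets of clusters that can be current during the procedure with merge function \<open>M\<close>; ties are broken arbitrarily.\<close>

inductive linkage_stage :: "('x set \<Rightarrow> 'x set \<Rightarrow> real) \<Rightarrow> 'x set \<Rightarrow> 'x set set \<Rightarrow> bool"
  for M S where
  start: "linkage_stage M S ((\<lambda>x. {x}) ` S)"
| merge: "linkage_stage M S \<C> \<Longrightarrow> A \<in> \<C> \<Longrightarrow> B \<in> \<C> \<Longrightarrow> A \<noteq> B \<Longrightarrow>
     (\<forall>A'\<in>\<C>. \<forall>B'\<in>\<C>. A' \<noteq> B' \<longrightarrow> M A B \<le> M A' B') \<Longrightarrow>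
     linkage_stage M S (insert (A \<union> B) (\<C> - {A, B}))"


section \<open>The region adjacency graph\<close>

text \<open>Here \<open>f \<rho> i j\<close> stands for the merge function value of clusters \<open>i\<close> and \<open>j\<close> at parameter \<open>\<rho>\<close>.
  The competitors are pairs of distinct clusters: a cluster is never merged with itself.\<close>

definition region ::
  "nat \<Rightarrow> (nat \<Rightarrow> real) set \<Rightarrow> ((nat \<Rightarrow> real) \<Rightarrow> nat \<Rightarrow> nat \<Rightarrow> real) \<Rightarrow> nat \<times> nat \<Rightarrow> (nat \<Rightarrow> real) set"
  where
  "region n P f = (\<lambda>(i, j). {\<rho>\<in>P. \<forall>i'<n. \<forall>j'<n. i' \<noteq> j' \<longrightarrow> f \<rho> i j \<le> f \<rho> i' j'})"

definition verts :: "nat \<Rightarrow> (nat \<times> nat) set" where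
  "verts n = {(i, j). i < j \<and> j < n}"

definition edges ::
  "nat \<Rightarrow> (nat \<Rightarrow> real) set \<Rightarrow> ((nat \<Rightarrow> real) \<Rightarrow> nat \<Rightarrow> nat \<Rightarrow> real) \<Rightarrow> (nat \<times> nat) set set" where
  "edges n P f = {{u, v} | u v. u \<in> verts n \<and> v \<in> verts n \<and> u \<noteq> v \<and> region n P f u \<inter> region n P f v \<noteq> {}}"

definition nonempty_verts ::
  "nat \<Rightarrow> (nat \<Rightarrow> real) set \<Rightarrow> ((nat \<Rightarrow> real) \<Rightarrow> nat \<Rightarrow> nat \<Rightarrow> real) \<Rightarrow> (nat \<times> nat) set" where
  "nonempty_verts n P f = {v \<in> verts n. region n P f v \<noteq> {}}"


section \<open>Linear programs\<close>

text \<open>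
  A linear program over the domain \<open>P\<close> with \<open>d\<close> variables and \<open>e\<close> constraints: minimise
  \<open>\<Sum>k<d. c k * x k\<close> over \<open>x \<in> P\<close> subject to \<open>(\<Sum>k<d. A r k * x k) \<le> A r d\<close> for \<open>r < e\<close>; the right-hand
  sides are stored in column \<open>d\<close>.
\<close>

definition lp_feasible :: "nat \<Rightarrow> (nat \<Rightarrow> real) set \<Rightarrow> nat \<Rightarrow> (nat \<Rightarrow> nat \<Rightarrow> real) \<Rightarrow> (nat \<Rightarrow> real) set" where
  "lp_feasible d P e A = {x\<in>P. \<forall>r<e. (\<Sum>k<d. A r k * x k) \<le> A r d}"

type_synonym solver = "nat \<Rightarrow> (nat \<Rightarrow> real) \<Rightarrow> (nat \<Rightarrow> nat \<Rightarrow> real) \<Rightarrow> (nat \<Rightarrow> real) option"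

definition lp_solver :: "nat \<Rightarrow> (nat \<Rightarrow> real) set \<Rightarrow> solver \<Rightarrow> bool" where
  "lp_solver d P lp \<longleftrightarrow>
     (\<forall>e c A. case lp e c A of
        None \<Rightarrow> lp_feasible d P e A = {}
      | Some x \<Rightarrow> x \<in> lp_feasible d P e A \<and>
          (\<forall>y\<in>lp_feasible d P e A. (\<Sum>k<d. c k * x k) \<le> (\<Sum>k<d. c k * y k)))"

text \<open>
  Admissible cost functions \<open>LP d e\<close>: more constraints do not make the worst case cheaper, and at least
  the \<open>(d + 1) * (e + 1)\<close> entries of the tableau are read.
\<close>

definition lp_cost_function :: "(nat \<Rightarrow> nat \<Rightarrow> nat) \<Rightarrow> bool" where
  "lp_cost_function LP \<longleftrightarrow> (\<forall>d. mono (LP d)) \<and> (\<forall>d e. (d + 1) * (e + 1) \<le> LP d e)"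


section \<open>Real RAM with access to base merge values and an LP solver\<close>

text \<open>
  Registers and arrays hold naturals or reals; arrays are numbered by naturals. Every operation costs
  one time unit, except \<open>Base\<close> and \<open>Solve\<close>, whose costs are part of the environment. Naturals have only
  addition and truncated subtraction, and there are no real constants other than casts of naturals, so
  that no information can be hidden in long numbers or in the program text.
\<close>

record state =
  nreg :: "nat \<Rightarrow> nat"
  narr :: "nat \<Rightarrow> nat \<Rightarrow> nat"
  rreg :: "nat \<Rightarrow> real"
  rarr :: "nat \<Rightarrow> nat \<Rightarrow> real"

record environment =
  dim :: nat
  base_val :: "nat \<Rightarrow> nat \<Rightarrow> nat \<Rightarrow> real"
  base_cost :: "nat \<Rightarrow> nat \<Rightarrow> nat \<Rightarrow> nat"
  solve :: solver
  solve_cost :: "nat \<Rightarrow> nat \<Rightarrow> nat"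

type_synonym reg = nat

text \<open>
  \<open>Base x k a b\<close> fetches the \<open>k\<close>-th base merge value of clusters \<open>a\<close> and \<open>b\<close>. \<open>Solve g ob r e y\<close> solves
  the linear program whose objective is in array \<open>ob\<close> and whose \<open>e\<close> constraints are in the arrays
  \<open>r, r + 1, \<dots>\<close>; it sets \<open>g\<close> to 0 if the program is infeasible, and otherwise sets \<open>g\<close> to 1 and writes
  an optimal point to array \<open>y\<close>. All arguments of instructions except the constant in \<open>NConst\<close> are
  registers.
\<close>

datatype instr =
    NConst reg nat
  | NAdd reg reg reg
  | NSub reg reg reg
  | NLoad reg reg reg
  | NStore reg reg reg
  | RCast reg reg
  | RAdd reg reg reg
  | RSub reg reg reg
  | RMul reg reg reg
  | RDiv reg reg reg
  | RLoad reg reg reg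
  | RStore reg reg reg
  | Base reg reg reg reg
  | Solve reg reg reg reg reg

datatype test = NLess reg reg | RLess reg reg

datatype com = Skip | Do instr | Seq com com | Cond test com com | While test com

abbreviation upd2 :: "(nat \<Rightarrow> nat \<Rightarrow> 'v) \<Rightarrow> nat \<Rightarrow> nat \<Rightarrow> 'v \<Rightarrow> nat \<Rightarrow> nat \<Rightarrow> 'v" where
  "upd2 h a i v \<equiv> h(a := (h a)(i := v))"

fun effect :: "environment \<Rightarrow> instr \<Rightarrow> state \<Rightarrow> state" where
  "effect _ (NConst v c) s = s\<lparr>nreg := (nreg s)(v := c)\<rparr>"
| "effect _ (NAdd v a b) s = s\<lparr>nreg := (nreg s)(v := nreg s a + nreg s b)\<rparr>"
| "effect _ (NSub v a b) s = s\<lparr>nreg := (nreg s)(v := nreg s a - nreg s b)\<rparr>"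
| "effect _ (NLoad v a i) s = s\<lparr>nreg := (nreg s)(v := narr s (nreg s a) (nreg s i))\<rparr>"
| "effect _ (NStore a i v) s = s\<lparr>narr := upd2 (narr s) (nreg s a) (nreg s i) (nreg s v)\<rparr>"
| "effect _ (RCast x v) s = s\<lparr>rreg := (rreg s)(x := real (nreg s v))\<rparr>"
| "effect _ (RAdd x y z) s = s\<lparr>rreg := (rreg s)(x := rreg s y + rreg s z)\<rparr>"
| "effect _ (RSub x y z) s = s\<lparr>rreg := (rreg s)(x := rreg s y - rreg s z)\<rparr>"
| "effect _ (RMul x y z) s = s\<lparr>rreg := (rreg s)(x := rreg s y * rreg s z)\<rparr>"
| "effect _ (RDiv x y z) s = s\<lparr>rreg := (rreg s)(x := rreg s y / rreg s z)\<rparr>"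
| "effect _ (RLoad x a i) s = s\<lparr>rreg := (rreg s)(x := rarr s (nreg s a) (nreg s i))\<rparr>"
| "effect _ (RStore a i x) s = s\<lparr>rarr := upd2 (rarr s) (nreg s a) (nreg s i) (rreg s x)\<rparr>"
| "effect env (Base x k a b) s =
     s\<lparr>rreg := (rreg s)(x := base_val env (nreg s k) (nreg s a) (nreg s b))\<rparr>"
| "effect env (Solve g ob r e y) s =
     (case solve env (nreg s e) (rarr s (nreg s ob)) (\<lambda>i. rarr s (nreg s r + i)) of
        None \<Rightarrow> s\<lparr>nreg := (nreg s)(g := 0)\<rparr>
      | Some p \<Rightarrow> s\<lparr>nreg := (nreg s)(g := 1),
          rarr := (rarr s)(nreg s y :=
            (\<lambda>k. if k < dim env then p k else rarr s (nreg s y) k))\<rparr>)"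

fun instr_cost :: "environment \<Rightarrow> instr \<Rightarrow> state \<Rightarrow> nat" where
  "instr_cost env (Base x k a b) s = base_cost env (nreg s k) (nreg s a) (nreg s b)"
| "instr_cost env (Solve g ob r e y) s = solve_cost env (dim env) (nreg s e)"
| "instr_cost _ _ _ = 1"

fun holds :: "test \<Rightarrow> state \<Rightarrow> bool" where
  "holds (NLess a b) s \<longleftrightarrow> nreg s a < nreg s b"
| "holds (RLess x y) s \<longleftrightarrow> rreg s x < rreg s y"

text \<open>\<open>exec env c s t s'\<close>: started in \<open>s\<close>, command \<open>c\<close> terminates in \<open>s'\<close> after exactly \<open>t\<close> time units.\<close>

inductive exec :: "environment \<Rightarrow> com \<Rightarrow> state \<Rightarrow> nat \<Rightarrow> state \<Rightarrow> bool" for env where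
  Skip: "exec env Skip s 1 s"
| Do: "exec env (Do i) s (instr_cost env i s) (effect env i s)"
| Seq: "exec env c1 s t1 s1 \<Longrightarrow> exec env c2 s1 t2 s2 \<Longrightarrow> exec env (Seq c1 c2) s (t1 + t2) s2"
| CondT: "holds b s \<Longrightarrow> exec env c1 s t s' \<Longrightarrow> exec env (Cond b c1 c2) s (1 + t) s'"
| CondF: "\<not> holds b s \<Longrightarrow> exec env c2 s t s' \<Longrightarrow> exec env (Cond b c1 c2) s (1 + t) s'"
| WhileF: "\<not> holds b s \<Longrightarrow> exec env (While b c) s 1 s"
| WhileT: "holds b s \<Longrightarrow> exec env c s t1 s1 \<Longrightarrow> exec env (While b c) s1 t2 s2 \<Longrightarrow>
     exec env (While b c) s (1 + t1 + t2) s2"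

text \<open>The program is given only the number of clusters and the dimension; it returns a set of pairs of
  cluster indices as a list of length \<open>nreg s 0\<close>.\<close>

definition init_state :: "nat \<Rightarrow> nat \<Rightarrow> state" where
  "init_state n d =
     \<lparr>nreg = (\<lambda>_. 0)(0 := n, 1 := d), narr = (\<lambda>_ _. 0), rreg = (\<lambda>_. 0), rarr = (\<lambda>_ _. 0)\<rparr>"

definition result :: "state \<Rightarrow> (nat \<times> nat) set" where
  "result s = {(narr s 0 r, narr s 1 r) | r. r < nreg s 0}"

text \<open>
  The access of an algorithm to the instance: base values \<open>D\<^sub>i(C\<^sub>a, C\<^sub>b; d\<^sub>j)\<close> at cost \<open>\<kappa> k a b\<close>, where \<open>k\<close>
  is the index of \<open>(i, j)\<close>, and linear programs over \<open>P\<close>.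
\<close>

definition linkage_env ::
  "nat \<Rightarrow> nat \<Rightarrow> (nat \<Rightarrow> 'x merge_fun) \<Rightarrow> (nat \<Rightarrow> 'x metric) \<Rightarrow> (nat \<Rightarrow> 'x set) \<Rightarrow>
   (nat \<Rightarrow> nat \<Rightarrow> nat \<Rightarrow> nat) \<Rightarrow> solver \<Rightarrow> (nat \<Rightarrow> nat \<Rightarrow> nat) \<Rightarrow> environment" where
  "linkage_env l m D \<delta> C \<kappa> lp LP =
     \<lparr>dim = l * m - 1,
      base_val = (\<lambda>k a b. D (k div m) (C a) (C b) (\<delta> (k mod m))),
      base_cost = \<kappa>, solve = lp, solve_cost = LP\<rparr>"

text \<open>Time to evaluate the defining sum of the interpolated merge function on clusters \<open>a\<close> and \<open>b\<close>: each
  of the \<open>N = l * m\<close> summands takes a base value, a multiplication and an addition.\<close>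

definition merge_time :: "nat \<Rightarrow> (nat \<Rightarrow> nat \<Rightarrow> nat \<Rightarrow> nat) \<Rightarrow> nat \<Rightarrow> nat \<Rightarrow> nat" where
  "merge_time N \<kappa> a b = (\<Sum>k<N. \<kappa> k a b + 2)"

end

theory Submission
  imports Defs
begin

text \<open>
  Call a pair of clusters attained if its region is nonempty, that is, if its affine merge value touches the
  lower envelope of all pairs somewhere on \<open>P\<close>. The program maintains a nonempty set \<open>W\<close> of attained pairs.
  To examine a pair \<open>p\<close>, it fixes some \<open>w\<^sub>0 \<in> W\<close> and minimises \<open>f\<^sub>p - f\<^bsub>w\<^sub>0\<^esub>\<close> over \<open>P\<close> subject to
  \<open>f\<^sub>p \<le> f\<^sub>w\<close> for \<open>w \<in> W - {w\<^sub>0}\<close>. If there is no feasible point or the optimum is positive, then \<open>p\<close> lies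
  strictly above the envelope of \<open>W\<close> everywhere and is discarded. Otherwise the optimal point \<open>\<rho>\<close> satisfies
  \<open>f\<^sub>p \<le> f\<^sub>w\<close> for all \<open>w \<in> W\<close>, so a pair minimising the merge value at \<open>\<rho>\<close> (with ties broken in favour of \<open>p\<close>)
  is attained and not yet in \<open>W\<close>. Hence at most \<open>n\<^sup>2 + V\<close> programs are solved and at most \<open>V\<close> minima over all
  pairs are computed.

  Each program has \<open>|W| - 1 \<le> V - 1\<close> constraints, and \<open>V - 1 \<le> E\<close> because the region adjacency graph is
  connected on the attained pairs: the regions are closed and cover \<open>P\<close>, so along a segment in \<open>P\<close>
  they cannot be separated.
\<close>

section \<open>Total correctness with running times\<close>

text \<open>A weakest precondition whose postcondition also sees the running time; the existential
  form is the one that the theorem asks for. For all commands but loops, the equations below compute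
  it by rewriting.\<close>

definition runs :: "environment \<Rightarrow> com \<Rightarrow> state \<Rightarrow> (nat \<Rightarrow> state \<Rightarrow> bool) \<Rightarrow> bool" where
  "runs env c s Q \<longleftrightarrow> (\<exists>t s'. exec env c s t s' \<and> Q t s')"

inductive_cases exec_SkipE: "exec env Skip s t s'"
inductive_cases exec_DoE: "exec env (Do i) s t s'"
inductive_cases exec_SeqE: "exec env (Seq c1 c2) s t s'"
inductive_cases exec_CondE: "exec env (Cond b c1 c2) s t s'"

lemma runs_Skip [simp]: "runs env Skip s Q \<longleftrightarrow> Q 1 s"
  unfolding runs_def by (metis exec.Skip exec_SkipE)

lemma runs_Do [simp]: "runs env (Do i) s Q \<longleftrightarrow> Q (instr_cost env i s) (effect env i s)"
  unfolding runs_def by (auto intro: exec.Do elim: exec_DoE)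

lemma runs_Seq [simp]:
  "runs env (Seq c1 c2) s Q \<longleftrightarrow> runs env c1 s (\<lambda>t1 s1. runs env c2 s1 (\<lambda>t2 s2. Q (t1 + t2) s2))"
  unfolding runs_def by (auto intro: exec.Seq elim!: exec_SeqE)

lemma runs_Cond [simp]:
  "runs env (Cond b c1 c2) s Q \<longleftrightarrow>
     (if holds b s then runs env c1 s (\<lambda>t s'. Q (1 + t) s') else runs env c2 s (\<lambda>t s'. Q (1 + t) s'))"
  unfolding runs_def by (cases "holds b s") (auto elim!: exec_CondE, (metis exec.CondT exec.CondF plus_1_eq_Suc)+)

lemma runs_mono:
  assumes "runs env c s Q" and "\<And>t s'. Q t s' \<Longrightarrow> Q' t s'"
  shows "runs env c s Q'"
  using assms unfolding runs_def by blast

text \<open>The potential \<open>\<Phi>\<close> pays for every iteration, so it is also the termination measure.\<close>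

lemma runs_While:
  fixes \<Phi> :: "state \<Rightarrow> nat"
  assumes I: "I s"
    and step: "\<And>s. I s \<Longrightarrow> holds b s \<Longrightarrow> runs env c s (\<lambda>t s'. I s' \<and> t + 1 + \<Phi> s' \<le> \<Phi> s)"
    and post: "\<And>t s'. I s' \<Longrightarrow> \<not> holds b s' \<Longrightarrow> t \<le> \<Phi> s + 1 \<Longrightarrow> Q t s'"
  shows "runs env (While b c) s Q"
proof -
  have "\<exists>t s'. exec env (While b c) s t s' \<and> I s' \<and> \<not> holds b s' \<and> t \<le> \<Phi> s + 1"
    using I
  proof (induction "\<Phi> s" arbitrary: s rule: less_induct)
    case less
    show ?case
    proof (cases "holds b s")
      case False
      then show ?thesis using exec.WhileF less.prems by (meson le_add2)
    next
      case True
      obtain t1 s1 where 1: "exec env c s t1 s1" "I s1" "t1 + 1 + \<Phi> s1 \<le> \<Phi> s"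
        using step[OF less.prems True] unfolding runs_def by blast
      then obtain t2 s2 where
        2: "exec env (While b c) s1 t2 s2" "I s2" "\<not> holds b s2" "t2 \<le> \<Phi> s1 + 1"
        using less.hyps[of s1] by force
      have "exec env (While b c) s (1 + t1 + t2) s2"
        using exec.WhileT[OF True 1(1) 2(1)] .
      then show ?thesis using 1 2 by (intro exI[of _ "1 + t1 + t2"] exI[of _ s2]) simp
    qed
  qed
  then show ?thesis unfolding runs_def using post by blast
qed

section \<open>The program\<close>

text \<open>
  Pairs of clusters are numbered from 1, and \<open>rTop\<close> is the first unused number. Real array 0 holds a point of
  \<open>P\<close>, array \<open>p\<close> the coefficients of the merge value of pair \<open>p\<close>, and the arrays from \<open>rTop\<close> on the current linear
  program: its objective first, then its constraints. Natural arrays 0 and 1 are the output, 2 and 3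
  list the components of the pairs, 4 flags the pairs already found, and 5 lists their numbers.
\<close>

abbreviation (input) "rZero \<equiv> 2 :: reg"
abbreviation (input) "rOne \<equiv> 3 :: reg"
abbreviation (input) "rDim \<equiv> 4 :: reg"
abbreviation (input) "rDim1 \<equiv> 5 :: reg"
abbreviation (input) "rNum \<equiv> 6 :: reg"
abbreviation (input) "rTop \<equiv> 7 :: reg"
abbreviation (input) "rI \<equiv> 8 :: reg"
abbreviation (input) "rJ \<equiv> 9 :: reg"
abbreviation (input) "rK \<equiv> 10 :: reg"
abbreviation (input) "rG \<equiv> 11 :: reg"
abbreviation (input) "rCnt \<equiv> 12 :: reg"
abbreviation (input) "rP \<equiv> 13 :: reg"
abbreviation (input) "rQ \<equiv> 14 :: reg"
abbreviation (input) "rR \<equiv> 15 :: reg"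
abbreviation (input) "rU \<equiv> 16 :: reg"
abbreviation (input) "rT \<equiv> 17 :: reg"
abbreviation (input) "rA \<equiv> 18 :: reg"
abbreviation (input) "rTwo \<equiv> 19 :: reg"
abbreviation (input) "rThree \<equiv> 20 :: reg"
abbreviation (input) "rFour \<equiv> 21 :: reg"
abbreviation (input) "rFive \<equiv> 22 :: reg"

abbreviation (input) "xZero \<equiv> 2 :: reg"
abbreviation (input) "xAcc \<equiv> 3 :: reg"
abbreviation (input) "xA \<equiv> 4 :: reg"
abbreviation (input) "xB \<equiv> 5 :: reg"
abbreviation (input) "xBest \<equiv> 6 :: reg"

fun block :: "com list \<Rightarrow> com" where
  "block [] = Skip"
| "block [c] = c"
| "block (c # c' # cs) = Seq c (block (c' # cs))"

text \<open>When the loop ends, \<open>rK\<close> equals the dimension, so the last load reads the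
  constant column. The last store of \<open>fill_row\<close> writes it in the same way.\<close>

definition evaluate :: "reg \<Rightarrow> com" where
  "evaluate a = block
     [Do (RCast xAcc rZero), Do (NConst rK 0),
      While (NLess rK rDim) (block
        [Do (RLoad xA a rK), Do (RLoad xB rZero rK), Do (RMul xA xA xB), Do (RAdd xAcc xAcc xA),
         Do (NAdd rK rK rOne)]),
      Do (RLoad xA a rK), Do (RSub xAcc xAcc xA)]"

definition fill_row :: com where
  "fill_row = block
     [Do (Base xAcc rDim rI rJ), Do (NConst rK 0),
      While (NLess rK rDim) (block
        [Do (Base xA rK rI rJ), Do (RSub xA xA xAcc), Do (RStore rTop rK xA), Do (NAdd rK rK rOne)]),
      Do (RSub xA xZero xAcc), Do (RStore rTop rK xA)]"

definition tabulate :: com where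
  "tabulate = block
     [Do (NConst rTop 1), Do (NConst rJ 0),
      While (NLess rJ rNum) (block
        [Do (NConst rI 0),
         While (NLess rI rJ) (block
           [Do (NStore rTwo rTop rI), Do (NStore rThree rTop rJ), fill_row,
            Do (NAdd rTop rTop rOne), Do (NAdd rI rI rOne)]),
         Do (NAdd rJ rJ rOne)])]"

definition minimize :: com where
  "minimize = block
     [evaluate rQ, Do (RAdd xBest xAcc xZero), Do (NConst rU 1),
      While (NLess rU rTop) (block
        [evaluate rU,
         Cond (RLess xAcc xBest) (block [Do (RAdd xBest xAcc xZero), Do (NAdd rQ rU rZero)]) Skip,
         Do (NAdd rU rU rOne)])]"

definition report :: com where
  "report = block
     [Do (NStore rFive rCnt rQ),
      Do (NLoad rT rTwo rQ), Do (NStore rZero rCnt rT),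
      Do (NLoad rT rThree rQ), Do (NStore rOne rCnt rT),
      Do (NStore rFour rQ rOne), Do (NAdd rCnt rCnt rOne)]"

definition add_minimizer :: com where
  "add_minimizer = block [minimize, report]"

definition build_rows :: com where
  "build_rows = block
     [Do (NConst rR 0),
      While (NLess rR rCnt) (block
        [Do (NLoad rT rFive rR), Do (NAdd rA rTop rR), Do (NConst rK 0),
         While (NLess rK rDim1) (block
           [Do (RLoad xA rP rK), Do (RLoad xB rT rK), Do (RSub xA xA xB), Do (RStore rA rK xA),
            Do (NAdd rK rK rOne)]),
         Do (NAdd rR rR rOne)])]"

text \<open>One found pair goes into the objective, which leaves \<open>rCnt - 1\<close>
  constraints. With a constraint for every found pair there could be \<open>E + 1\<close> of them,
  one more than the bound allows.\<close>

definition pose :: com where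
  "pose = block
     [build_rows, Do (NAdd rA rTop rOne), Do (NSub rT rCnt rOne), Do (Solve rG rTop rA rT rZero)]"

text \<open>After a report \<open>rP\<close> stays put: the minimiser may be another pair, and then
  the pair \<open>rP\<close> is still undecided.\<close>

definition judge :: com where
  "judge =
     Cond (NLess rZero rG) (block
       [Do (NLoad rT rFive rZero), evaluate rT, Do (RAdd xBest xAcc xZero), evaluate rP,
        Cond (RLess xBest xAcc) (Do (NAdd rP rP rOne))
          (block [Do (NAdd rQ rP rZero), add_minimizer])])
       (Do (NAdd rP rP rOne))"

definition examine :: com where
  "examine = block
     [Do (NLoad rT rFour rP),
      Cond (NLess rZero rT) (Do (NAdd rP rP rOne)) (block [pose, judge])]"

definition initialize :: com where
  "initialize = block
     [Do (NConst rOne 1), Do (NAdd rDim 1 rZero), Do (NAdd rDim1 1 rOne), Do (NAdd rNum 0 rZero),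
      Do (NConst rTwo 2), Do (NConst rThree 3), Do (NConst rFour 4), Do (NConst rFive 5),
      Do (Solve rG rZero rZero rZero rZero)]"

text \<open>The table costs about \<open>n\<^sup>2 * K\<close>, which
  \<open>V * n\<^sup>2 * K\<close> covers only if some pair is attained. Hence emptiness of
  \<open>P\<close> is decided before tabulating, by the program without constraints that ends
  \<open>initialize\<close>. Its solution, left in array 0, is the point at which the first minimum
  is taken.\<close>

definition find_vertices :: com where
  "find_vertices = block
     [initialize,
      Cond (NLess rZero rG) (block
        [tabulate,
         Cond (NLess rOne rTop) (block
           [Do (NConst rQ 1), add_minimizer, Do (NConst rP 1), While (NLess rP rTop) examine])
           Skip])
        Skip,
      Do (NAdd 0 rCnt rZero)]"

section \<open>Correctness and running time of the program\<close>

text \<open>Besides time and value the postcondition lists what is left unchanged, so that callers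
  can carry their invariants across. The potential of the loop is the number of remaining rounds
  times the cost of a round, test included.\<close>

lemma runs_evaluate:
  assumes "nreg s rZero = 0" "nreg s rOne = 1" "nreg s rDim = d" "a \<noteq> rK"
  shows "runs env (evaluate a) s (\<lambda>t s'. t \<le> 6 * (d + 1) \<and>
    (\<forall>r. r \<notin> {rK} \<longrightarrow> nreg s' r = nreg s r) \<and>
    narr s' = narr s \<and> rarr s' = rarr s \<and>
    rreg s' xAcc = (\<Sum>k<d. rarr s (nreg s a) k * rarr s 0 k) - rarr s (nreg s a) d \<and>
    (\<forall>x. x \<notin> {xAcc, xA, xB} \<longrightarrow> rreg s' x = rreg s x))"
  unfolding evaluate_def
  apply (simp add: assms)
  apply (rule runs_While[where \<Phi> = "\<lambda>s'. (d - nreg s' rK) * 6" and I = "\<lambda>s'. nreg s' rK \<le> d \<and>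
    (\<forall>r. r \<notin> {rK} \<longrightarrow> nreg s' r = nreg s r) \<and> narr s' = narr s \<and> rarr s' = rarr s \<and>
    rreg s' xAcc = (\<Sum>k<nreg s' rK. rarr s (nreg s a) k * rarr s 0 k) \<and>
    (\<forall>x. x \<notin> {xAcc, xA, xB} \<longrightarrow> rreg s' x = rreg s x)"])
  subgoal by (simp add: assms)
  subgoal by (simp add: assms)
  subgoal by (simp add: assms)
  done


lemma countdown: "k < (m::nat) \<Longrightarrow> (m - k) * c = c + (m - Suc k) * c"
  by (metis Suc_diff_Suc mult_Suc)

definition consts_ok :: "nat \<Rightarrow> nat \<Rightarrow> state \<Rightarrow> bool" where
  "consts_ok n d s \<longleftrightarrow> nreg s rZero = 0 \<and> nreg s rOne = 1 \<and> nreg s rDim = d \<and> nreg s rDim1 = d + 1 \<and>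
     nreg s rNum = n \<and> nreg s rTwo = 2 \<and> nreg s rThree = 3 \<and> nreg s rFour = 4 \<and> nreg s rFive = 5 \<and>
     rreg s xZero = 0"

text \<open>Column \<open>dim env\<close> holds the negated constant term, so that the difference of two rows is directly
  a constraint row with its right-hand side.\<close>

definition coef :: "environment \<Rightarrow> nat \<times> nat \<Rightarrow> nat \<Rightarrow> real" where
  "coef env v k =
     (if k < dim env then base_val env k (fst v) (snd v) else 0)
     - base_val env (dim env) (fst v) (snd v)"

text \<open>The analysis of the program uses only this affine form;
  \<open>interp_eq_pair_value\<close> identifies it with the interpolated merge function.\<close>

definition pair_value :: "environment \<Rightarrow> (nat \<Rightarrow> real) \<Rightarrow> nat \<times> nat \<Rightarrow> real" where
  "pair_value env \<rho> v = (\<Sum>k<dim env. coef env v k * \<rho> k) - coef env v (dim env)"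

lemma runs_fill_row:
  assumes "consts_ok n (dim env) s"
  shows "runs env fill_row s (\<lambda>t s'.
    t \<le> 2 * (\<Sum>k<dim env + 1. base_cost env k (nreg s rI) (nreg s rJ) + 2) \<and>
    (\<forall>r. r \<notin> {rK} \<longrightarrow> nreg s' r = nreg s r) \<and> narr s' = narr s \<and>
    (\<forall>a. a \<noteq> nreg s rTop \<longrightarrow> rarr s' a = rarr s a) \<and>
    (\<forall>k\<le>dim env. rarr s' (nreg s rTop) k = coef env (nreg s rI, nreg s rJ) k) \<and>
    (\<forall>x. x \<notin> {xAcc, xA} \<longrightarrow> rreg s' x = rreg s x))"
proof -
  \<comment> \<open>A round costs a base value, three instructions and the test. As base costs may
    be 0, this overhead is charged to the 2 in each summand of \<open>merge_time\<close>, at the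
    price of a factor 2.\<close>
  have double_sum: "(\<Sum>k<dim env. base_cost env k (nreg s rI) (nreg s rJ) + 4)
    \<le> 2 * (\<Sum>k<dim env. base_cost env k (nreg s rI) (nreg s rJ) + 2)"
    unfolding sum_distrib_left by (intro sum_mono) simp
  show ?thesis
    unfolding fill_row_def
    using assms
    apply (simp add: consts_ok_def)
    \<comment> \<open>Rounds differ in cost, so the potential sums over the columns still to be
      filled.\<close>
    apply (rule runs_While[where \<Phi> = "\<lambda>s'. \<Sum>k\<in>{nreg s' rK..<dim env}. base_cost env k (nreg s rI) (nreg s rJ) + 4"
      and I = "\<lambda>s'. nreg s' rK \<le> dim env \<and>
      (\<forall>r. r \<notin> {rK} \<longrightarrow> nreg s' r = nreg s r) \<and> narr s' = narr s \<and>
      (\<forall>a. a \<noteq> nreg s rTop \<longrightarrow> rarr s' a = rarr s a) \<and>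
      (\<forall>k<nreg s' rK. rarr s' (nreg s rTop) k = coef env (nreg s rI, nreg s rJ) k) \<and>
      rreg s' xAcc = base_val env (dim env) (nreg s rI) (nreg s rJ) \<and>
      (\<forall>x. x \<notin> {xAcc, xA} \<longrightarrow> rreg s' x = rreg s x)"])
    subgoal by simp
    subgoal for s' by (auto simp add: less_Suc_eq coef_def sum.atLeast_Suc_lessThan)
    subgoal for t s'
      using double_sum
      by (clarsimp simp add: coef_def atLeast0LessThan)
    done
qed

lemma minimize_time:
  "1 < L \<Longrightarrow> t \<le> Suc ((L - Suc 0) * (11 + 6 * d)) \<Longrightarrow> t0 \<le> 6 + 6 * d \<Longrightarrow>
     Suc (Suc (t0 + t)) \<le> 12 * L + 12 * L * (d::nat)"
  by (cases L) (auto simp: algebra_simps)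

text \<open>The candidate in \<open>rQ\<close> gives way only to a strictly smaller value. The
  clause recording this is what later shows that the minimiser is a new pair.\<close>

lemma runs_minimize:
  assumes "consts_ok n d s" "nreg s rTop = L" "nreg s rQ \<in> {1..<L}"
    and val: "\<And>p. p \<in> {1..<L} \<Longrightarrow> (\<Sum>k<d. rarr s p k * rarr s 0 k) - rarr s p d = val p"
  shows "runs env minimize s (\<lambda>t s'. t \<le> 12 * L * (d + 1) \<and>
    (\<forall>r. r \<notin> {rK, rU, rQ} \<longrightarrow> nreg s' r = nreg s r) \<and> narr s' = narr s \<and> rarr s' = rarr s \<and>
    nreg s' rQ \<in> {1..<L} \<and> (\<forall>p\<in>{1..<L}. val (nreg s' rQ) \<le> val p) \<and>
    (nreg s' rQ = nreg s rQ \<or> val (nreg s' rQ) < val (nreg s rQ)) \<and>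
    (\<forall>x. x \<notin> {xAcc, xA, xB, xBest} \<longrightarrow> rreg s' x = rreg s x))"
  unfolding minimize_def
  using assms(1-3)
  apply (simp add: consts_ok_def)
  apply (rule runs_mono[OF runs_evaluate[where d = d]])
      apply simp_all
  subgoal for t0 s0
    apply (rule runs_While[where \<Phi> = "\<lambda>s'. (L - nreg s' rU) * (6 * (d + 1) + 5)"
      and I = "\<lambda>s'. nreg s' rU \<in> {1..L} \<and>
    (\<forall>r. r \<notin> {rK, rU, rQ} \<longrightarrow> nreg s' r = nreg s r) \<and> narr s' = narr s \<and> rarr s' = rarr s \<and>
    nreg s' rQ \<in> {1..<L} \<and> (\<forall>p\<in>{1..<nreg s' rU}. val (nreg s' rQ) \<le> val p) \<and>
    (nreg s' rQ = nreg s rQ \<or> val (nreg s' rQ) < val (nreg s rQ)) \<and>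
    rreg s' xBest = val (nreg s' rQ) \<and>
    (\<forall>x. x \<notin> {xAcc, xA, xB, xBest} \<longrightarrow> rreg s' x = rreg s x)"])
    subgoal by (simp add: val)
    subgoal for s1
      apply simp
      apply (rule runs_mono[OF runs_evaluate[where d = d]])
          apply (simp_all add: val)
      apply (clarsimp simp: countdown[of "nreg s1 rU"] atLeastLessThanSuc)
      apply (rule conjI)
      subgoal by (meson less_imp_le order_trans)
      subgoal by (metis less_trans)
      done
    subgoal for t s1
      using minimize_time[of L t d t0] by clarsimp
    done
  done

lemma runs_report:
  assumes "consts_ok n d s"
  shows "runs env report s (\<lambda>t s'. t = 7 \<and>
    (\<forall>r. r \<notin> {rT, rCnt} \<longrightarrow> nreg s' r = nreg s r) \<and> nreg s' rCnt = nreg s rCnt + 1 \<and>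
    rreg s' = rreg s \<and> rarr s' = rarr s \<and> narr s' 2 = narr s 2 \<and> narr s' 3 = narr s 3 \<and>
    narr s' 0 = (narr s 0)(nreg s rCnt := narr s 2 (nreg s rQ)) \<and>
    narr s' 1 = (narr s 1)(nreg s rCnt := narr s 3 (nreg s rQ)) \<and>
    narr s' 4 = (narr s 4)(nreg s rQ := 1) \<and>
    narr s' 5 = (narr s 5)(nreg s rCnt := nreg s rQ))"
  unfolding report_def using assms by (simp add: consts_ok_def)

text \<open>Every array read has a number below \<open>L\<close> and every array written is some
  \<open>L + r\<close>, so the table and the point in array 0 survive.\<close>

lemma runs_build_rows:
  assumes "consts_ok n d s" "nreg s rTop = L" "nreg s rP \<in> {1..<L}" "\<And>r. r < nreg s rCnt \<Longrightarrow> narr s 5 r < L"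
  shows "runs env build_rows s (\<lambda>t s'. t \<le> 12 * nreg s rCnt * (d + 1) + 2 \<and>
    (\<forall>r. r \<notin> {rK, rR, rT, rA} \<longrightarrow> nreg s' r = nreg s r) \<and> narr s' = narr s \<and>
    (\<forall>a<L. rarr s' a = rarr s a) \<and>
    (\<forall>r<nreg s rCnt. \<forall>k\<le>d. rarr s' (L + r) k = rarr s (nreg s rP) k - rarr s (narr s 5 r) k) \<and>
    (\<forall>x. x \<notin> {xA, xB} \<longrightarrow> rreg s' x = rreg s x))"
  unfolding build_rows_def
  using assms
  apply (simp add: consts_ok_def)
  apply (rule runs_While[where \<Phi> = "\<lambda>s'. (nreg s rCnt - nreg s' rR) * (6 * (d + 1) + 6)"
    and I = "\<lambda>s'. nreg s' rR \<le> nreg s rCnt \<and>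
    (\<forall>r. r \<notin> {rK, rR, rT, rA} \<longrightarrow> nreg s' r = nreg s r) \<and> narr s' = narr s \<and>
    (\<forall>a<L. rarr s' a = rarr s a) \<and>
    (\<forall>r<nreg s' rR. \<forall>k\<le>d. rarr s' (L + r) k = rarr s (nreg s rP) k - rarr s (narr s 5 r) k) \<and>
    (\<forall>x. x \<notin> {xA, xB} \<longrightarrow> rreg s' x = rreg s x)"])
  subgoal by simp
  subgoal for s1
    apply simp
    apply (rule runs_While[where \<Phi> = "\<lambda>s'. (d + 1 - nreg s' rK) * 6"
    and I = "\<lambda>s'. nreg s' rK \<le> d + 1 \<and> nreg s' rA = L + nreg s1 rR \<and> nreg s' rT = narr s 5 (nreg s1 rR) \<and>
    (\<forall>r. r \<notin> {rK, rT, rA} \<longrightarrow> nreg s' r = nreg s1 r) \<and> narr s' = narr s \<and>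
    (\<forall>a. a \<noteq> L + nreg s1 rR \<longrightarrow> rarr s' a = rarr s1 a) \<and>
    (\<forall>k<nreg s' rK. rarr s' (L + nreg s1 rR) k = rarr s (nreg s rP) k - rarr s (narr s 5 (nreg s1 rR)) k) \<and>
    (\<forall>x. x \<notin> {xA, xB} \<longrightarrow> rreg s' x = rreg s x)"])
    subgoal by simp
    subgoal for s2
      apply clarsimp
      apply (subgoal_tac "nreg s rP \<noteq> L + nreg s1 rR \<and> narr s 5 (nreg s1 rR) \<noteq> L + nreg s1 rR")
      subgoal by (simp add: less_Suc_eq) (auto simp: Suc_diff_le)
      subgoal by (metis not_add_less1)
      done
    subgoal for t s2
      by (clarsimp simp: less_Suc_eq_le countdown[of "nreg s1 rR"]) (simp add: le_eq_less_or_eq[of _ "nreg s1 rR"], fastforce)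
    done
  subgoal for t s1 by (auto simp: algebra_simps)
  done

section \<open>Enumeration of the pairs and their coefficients\<close>

text \<open>Pairs are enumerated by second component: \<open>verts j\<close> are the completed
  columns, and column \<open>j\<close> is filled up to \<open>i\<close>. A full column
  \<open>j\<close> is then the same as an empty column \<open>Suc j\<close>, which links the inner
  loop to the outer one.\<close>

definition tabulated :: "environment \<Rightarrow> nat \<Rightarrow> nat \<Rightarrow> state \<Rightarrow> bool" where
  "tabulated env j i s \<longleftrightarrow> 1 \<le> nreg s rTop \<and>
     bij_betw (\<lambda>p. (narr s 2 p, narr s 3 p)) {1..<nreg s rTop} (verts j \<union> (\<lambda>a. (a, j)) ` {..<i}) \<and>
     (\<forall>p\<in>{1..<nreg s rTop}. \<forall>k\<le>dim env. rarr s p k = coef env (narr s 2 p, narr s 3 p) k)"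

lemma tabulated_Suc_0: "tabulated env (Suc j) 0 s \<longleftrightarrow> tabulated env j j s"
proof -
  have "verts (Suc j) = verts j \<union> (\<lambda>a. (a, j)) ` {..<j}"
    by (auto simp: verts_def less_Suc_eq)
  then show ?thesis by (simp add: tabulated_def)
qed

lemma tabulated_Suc:
  assumes tab: "tabulated env j i s" and top: "nreg s' rTop = Suc (nreg s rTop)"
    and n2: "narr s' 2 = (narr s 2)(nreg s rTop := i)" and n3: "narr s' 3 = (narr s 3)(nreg s rTop := j)"
    and old: "\<And>a. a \<noteq> nreg s rTop \<Longrightarrow> rarr s' a = rarr s a"
    and new: "\<And>k. k \<le> dim env \<Longrightarrow> rarr s' (nreg s rTop) k = coef env (i, j) k"
  shows "tabulated env j (Suc i) s'"
proof -
  let ?L = "nreg s rTop"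
  have L: "1 \<le> ?L" "{1..<nreg s' rTop} = insert ?L {1..<?L}" "?L \<notin> {1..<?L}"
    using tab top by (auto simp: tabulated_def)
  have "bij_betw (\<lambda>p. (narr s' 2 p, narr s' 3 p)) {1..<?L} (verts j \<union> (\<lambda>a. (a, j)) ` {..<i})"
    using tab n2 n3 unfolding tabulated_def
    by (subst bij_betw_cong[where g = "\<lambda>p. (narr s 2 p, narr s 3 p)"]) auto
  moreover have "(i, j) \<notin> verts j \<union> (\<lambda>a. (a, j)) ` {..<i}" by (auto simp: verts_def)
  ultimately have "bij_betw (\<lambda>p. (narr s' 2 p, narr s' 3 p)) (insert ?L {1..<?L})
      ((verts j \<union> (\<lambda>a. (a, j)) ` {..<i}) \<union> {(i, j)})"
    using notIn_Un_bij_betw[OF L(3), of "\<lambda>p. (narr s' 2 p, narr s' 3 p)"] n2 n3 by auto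
  moreover have "(verts j \<union> (\<lambda>a. (a, j)) ` {..<i}) \<union> {(i, j)} = verts j \<union> (\<lambda>a. (a, j)) ` {..<Suc i}"
    by (auto simp: less_Suc_eq)
  moreover have "\<forall>p\<in>insert ?L {1..<?L}. \<forall>k\<le>dim env. rarr s' p k = coef env (narr s' 2 p, narr s' 3 p) k"
    using tab n2 n3 old new by (auto simp: tabulated_def)
  ultimately show ?thesis
    unfolding tabulated_def L(2) using top by simp
qed

definition outside_table :: "state \<Rightarrow> state \<Rightarrow> bool" where
  "outside_table s s' \<longleftrightarrow> (\<forall>r. r \<notin> {rK, rTop, rI, rJ} \<longrightarrow> nreg s' r = nreg s r) \<and>
     (\<forall>a. a \<notin> {2, 3} \<longrightarrow> narr s' a = narr s a) \<and> rarr s' 0 = rarr s 0 \<and>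
     (\<forall>x. x \<notin> {xAcc, xA} \<longrightarrow> rreg s' x = rreg s x)"

lemma runs_table_entry:
  assumes co: "consts_ok n (dim env) s" and tab: "tabulated env (nreg s rJ) (nreg s rI) s"
    and K: "2 * (\<Sum>k<dim env + 1. base_cost env k (nreg s rI) (nreg s rJ) + 2) \<le> B"
  shows "runs env (block [Do (NStore rTwo rTop rI), Do (NStore rThree rTop rJ), fill_row,
            Do (NAdd rTop rTop rOne), Do (NAdd rI rI rOne)]) s
    (\<lambda>t s'. t \<le> B + 4 \<and> outside_table s s' \<and> nreg s' rJ = nreg s rJ \<and> nreg s' rI = Suc (nreg s rI) \<and>
       tabulated env (nreg s rJ) (Suc (nreg s rI)) s')"
  using co K
  apply (simp add: consts_ok_def)
  apply (rule runs_mono[OF runs_fill_row[of n]])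
   apply (simp add: consts_ok_def)
  apply clarsimp
  apply (rule conjI)
  subgoal using tab by (simp add: outside_table_def tabulated_def)
  subgoal by (rule tabulated_Suc[OF tab]) simp_all
  done

lemma round_time: "j < n \<Longrightarrow> t \<le> Suc (j * c) \<Longrightarrow> t \<le> Suc ((n - Suc 0) * (c::nat))"
  using mult_le_mono1[of j "n - Suc 0" c] by linarith

lemma runs_tabulate:
  assumes co: "consts_ok n (dim env) s"
    and K: "\<And>i j. i < j \<Longrightarrow> j < n \<Longrightarrow> (\<Sum>k<dim env + 1. base_cost env k i j + 2) \<le> K"
  shows "runs env tabulate s (\<lambda>t s'. t \<le> n * ((n - 1) * (2 * K + 5) + 4) + 3 \<and>
    outside_table s s' \<and> tabulated env n 0 s')"
  unfolding tabulate_def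
  apply (simp only: block.simps runs_Seq runs_Do)
  \<comment> \<open>Per entry, 5 stands for four instructions and the inner test; per column, 4
    stands for two instructions, the exit from the inner loop and the outer test. Every column is
    charged for \<open>n - 1\<close> entries.\<close>
  apply (rule runs_While[where \<Phi> = "\<lambda>s'. (n - nreg s' rJ) * ((n - 1) * (2 * K + 5) + 4)"
     and I = "\<lambda>s'. nreg s' rJ \<le> n \<and> outside_table s s' \<and> tabulated env (nreg s' rJ) 0 s'"])
  subgoal by (auto simp: outside_table_def tabulated_def verts_def bij_betw_def)
  subgoal for s1
    apply (simp only: runs_Seq runs_Do)
    apply (rule runs_While[where \<Phi> = "\<lambda>s'. (nreg s1 rJ - nreg s' rI) * (2 * K + 5)"
     and I = "\<lambda>s'. nreg s' rJ = nreg s1 rJ \<and> nreg s' rI \<le> nreg s' rJ \<and> outside_table s s' \<and>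
       tabulated env (nreg s' rJ) (nreg s' rI) s'"])
    subgoal by (auto simp: outside_table_def tabulated_def)
    subgoal for s2
      apply (rule runs_mono[OF runs_table_entry[unfolded block.simps, of n _ _ "2 * K"]])
      subgoal using co by (simp add: consts_ok_def outside_table_def)
      subgoal by metis
      subgoal using co K[of "nreg s2 rI" "nreg s1 rJ"] by (simp add: consts_ok_def outside_table_def)
      subgoal for t s3 by (clarsimp simp: countdown[of "nreg s2 rI"] outside_table_def)
      done
    subgoal for t s2
      using co round_time[of "nreg s1 rJ" n t "2 * K + 5"]
      apply (clarsimp simp: consts_ok_def)
      apply (subgoal_tac "nreg s2 rOne = 1 \<and> nreg s1 rNum = n")
      subgoal
        by (clarsimp simp: tabulated_Suc_0 countdown[of "nreg s1 rJ"])
          (simp add: outside_table_def tabulated_def)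
      subgoal by (simp add: outside_table_def)
      done
    done
  subgoal for t s1 using co by (clarsimp simp: consts_ok_def outside_table_def)
  done


section \<open>Linear programs that decide whether a pair is attained\<close>

text \<open>The set \<open>nonempty_verts\<close> as the program sees it: expressed by
  \<open>pair_value\<close>, with competitors only from \<open>verts n\<close>.\<close>

definition attained :: "environment \<Rightarrow> nat \<Rightarrow> (nat \<Rightarrow> real) set \<Rightarrow> (nat \<times> nat) set" where
  "attained env n P = {v \<in> verts n. \<exists>\<rho>\<in>P. \<forall>u\<in>verts n. pair_value env \<rho> v \<le> pair_value env \<rho> u}"

lemma row_difference:
  assumes "\<And>k. k \<le> dim env \<Longrightarrow> R k = coef env u k - coef env w k"
  shows "(\<Sum>k<dim env. R k * x k) - R (dim env) = pair_value env x u - pair_value env x w"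
proof -
  have "(\<Sum>k<dim env. R k * x k) = (\<Sum>k<dim env. coef env u k * x k - coef env w k * x k)"
    using assms by (intro sum.cong) (auto simp: left_diff_distrib)
  then show ?thesis using assms[of "dim env"] by (simp add: pair_value_def sum_subtractf)
qed

text \<open>A point where \<open>v\<close> is attained is feasible, and there \<open>v\<close> is
  not above \<open>w 0\<close>; so infeasibility or a positive optimal difference rules
  \<open>v\<close> out. Otherwise feasibility compares \<open>v\<close> with the pairs
  \<open>w r\<close> for \<open>0 < r\<close>, and the sign of the optimum compares it with
  \<open>w 0\<close>. The solver minimises only the linear part of the difference, which shifts all
  values by the same constant.\<close>

lemma solve_rows:
  assumes lp: "lp_solver (dim env) P (solve env)" and cnt: "0 < cnt" and v: "v \<in> verts n"
    and w: "\<And>r. r < cnt \<Longrightarrow> w r \<in> verts n"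
    and rows: "\<And>r k. r < cnt \<Longrightarrow> k \<le> dim env \<Longrightarrow> R r k = coef env v k - coef env (w r) k"
  shows "solve env (cnt - 1) (R 0) (\<lambda>i. R (Suc i)) = None \<Longrightarrow> v \<notin> attained env n P"
    and "solve env (cnt - 1) (R 0) (\<lambda>i. R (Suc i)) = Some x \<Longrightarrow> x \<in> P"
    and "solve env (cnt - 1) (R 0) (\<lambda>i. R (Suc i)) = Some x \<Longrightarrow>
      pair_value env x (w 0) < pair_value env x v \<Longrightarrow> v \<notin> attained env n P"
    and "solve env (cnt - 1) (R 0) (\<lambda>i. R (Suc i)) = Some x \<Longrightarrow>
      pair_value env x v \<le> pair_value env x (w 0) \<Longrightarrow> r < cnt \<Longrightarrow> pair_value env x v \<le> pair_value env x (w r)"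
proof -
  let ?F = "lp_feasible (dim env) P (cnt - 1) (\<lambda>i. R (Suc i))"
  let ?sol = "solve env (cnt - 1) (R 0) (\<lambda>i. R (Suc i))"
  have diff: "(\<Sum>k<dim env. R r k * x k) - R r (dim env) = pair_value env x v - pair_value env x (w r)"
    if "r < cnt" for r x
    by (rule row_difference) (simp add: rows that)
  \<comment> \<open>Constraint \<open>r\<close> of the program is row \<open>Suc r\<close>, since
    row 0 is the objective.\<close>
  have F: "x \<in> ?F \<longleftrightarrow> x \<in> P \<and> (\<forall>r. 0 < r \<and> r < cnt \<longrightarrow> pair_value env x v \<le> pair_value env x (w r))" for x
  proof -
    have "(\<Sum>k<dim env. R (Suc r) k * x k) \<le> R (Suc r) (dim env) \<longleftrightarrow>
        pair_value env x v \<le> pair_value env x (w (Suc r))" if "r < cnt - 1" for r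
      using diff[of "Suc r" x] that less_diff_conv[of r cnt 1] by auto
    then have "x \<in> ?F \<longleftrightarrow> x \<in> P \<and> (\<forall>r<cnt - 1. pair_value env x v \<le> pair_value env x (w (Suc r)))"
      by (simp add: lp_feasible_def)
    also have "(\<forall>r<cnt - 1. pair_value env x v \<le> pair_value env x (w (Suc r))) \<longleftrightarrow>
        (\<forall>r. 0 < r \<and> r < cnt \<longrightarrow> pair_value env x v \<le> pair_value env x (w r))"
      by (metis One_nat_def Suc_less_eq Suc_pred cnt gr0_conv_Suc zero_less_Suc)
    finally show ?thesis .
  qed
  have sol: "case ?sol of None \<Rightarrow> ?F = {}
      | Some x \<Rightarrow> x \<in> ?F \<and> (\<forall>y\<in>?F. (\<Sum>k<dim env. R 0 k * x k) \<le> (\<Sum>k<dim env. R 0 k * y k))"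
    using lp unfolding lp_solver_def by blast
  have att: "\<exists>\<rho>\<in>?F. pair_value env \<rho> v \<le> pair_value env \<rho> (w 0)" if "v \<in> attained env n P"
  proof -
    obtain \<rho> where \<rho>: "\<rho> \<in> P" "\<And>u. u \<in> verts n \<Longrightarrow> pair_value env \<rho> v \<le> pair_value env \<rho> u"
      using \<open>v \<in> attained env n P\<close> by (auto simp: attained_def)
    then have "\<rho> \<in> ?F" unfolding F using w by simp
    then show ?thesis using \<rho>(2)[OF w[OF cnt]] by blast
  qed
  show "?sol = None \<Longrightarrow> v \<notin> attained env n P" using sol att by auto
  show "?sol = Some x \<Longrightarrow> x \<in> P" using sol F by auto
  show "v \<notin> attained env n P" if "?sol = Some x" "pair_value env x (w 0) < pair_value env x v"
  proof
    assume "v \<in> attained env n P"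
    then obtain \<rho> where "\<rho> \<in> ?F" "pair_value env \<rho> v \<le> pair_value env \<rho> (w 0)" using att by blast
    moreover have "(\<Sum>k<dim env. R 0 k * x k) \<le> (\<Sum>k<dim env. R 0 k * \<rho> k)"
      using sol that(1) \<open>\<rho> \<in> ?F\<close> by simp
    ultimately show False using diff[OF cnt, of x] diff[OF cnt, of \<rho>] that(2) by linarith
  qed
  show "pair_value env x v \<le> pair_value env x (w r)"
    if "?sol = Some x" "pair_value env x v \<le> pair_value env x (w 0)" "r < cnt"
    using sol F that by (cases "r = 0") auto
qed

section \<open>The search loop and its invariants\<close>

text \<open>The enumeration is frozen as a bijection \<open>\<pi>\<close>, so that states during the
  search only have to agree with it.\<close>

locale search =
  fixes env :: environment and n :: nat and P :: "(nat \<Rightarrow> real) set"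
    and L :: nat and \<pi> :: "nat \<Rightarrow> nat \<times> nat"
  assumes bij: "bij_betw \<pi> {1..<L} (verts n)"
    and lp: "lp_solver (dim env) P (solve env)"
    and cost: "lp_cost_function (solve_cost env)"
begin

definition loaded :: "state \<Rightarrow> bool" where
  "loaded s \<longleftrightarrow> consts_ok n (dim env) s \<and> nreg s rTop = L \<and>
     (\<forall>p\<in>{1..<L}. narr s 2 p = fst (\<pi> p) \<and> narr s 3 p = snd (\<pi> p) \<and>
        (\<forall>k\<le>dim env. rarr s p k = coef env (\<pi> p) k))"

definition found :: "state \<Rightarrow> nat set" where
  "found s = narr s 5 ` {..<nreg s rCnt}"

text \<open>Injectivity makes \<open>rCnt\<close> the true number of found pairs, so it can be
  bounded by the number of attained ones.\<close>

definition recorded :: "state \<Rightarrow> bool" where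
  "recorded s \<longleftrightarrow> inj_on (narr s 5) {..<nreg s rCnt} \<and>
     (\<forall>r<nreg s rCnt. narr s 5 r \<in> {1..<L} \<and> \<pi> (narr s 5 r) \<in> attained env n P \<and>
        narr s 0 r = fst (\<pi> (narr s 5 r)) \<and> narr s 1 r = snd (\<pi> (narr s 5 r))) \<and>
     (\<forall>p\<in>{1..<L}. 0 < narr s 4 p \<longleftrightarrow> p \<in> found s)"

lemma pi_verts: "p \<in> {1..<L} \<Longrightarrow> \<pi> p \<in> verts n"
  using bij by (auto simp: bij_betw_def)

text \<open>The register numbers are those of \<open>rZero\<close> to \<open>rTop\<close> and of
  \<open>rTwo\<close> to \<open>rFive\<close>, which the search never writes.\<close>

lemma loaded_cong:
  assumes "loaded s" "\<And>r. r \<in> {2..7} \<union> {19..22} \<Longrightarrow> nreg s' r = nreg s r" "rreg s' xZero = rreg s xZero"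
    "narr s' 2 = narr s 2" "narr s' 3 = narr s 3" "\<And>p. p \<in> {1..<L} \<Longrightarrow> rarr s' p = rarr s p"
  shows "loaded s'"
  using assms by (simp add: loaded_def consts_ok_def)

lemma recorded_cong:
  assumes "recorded s" "nreg s' rCnt = nreg s rCnt" "narr s' = narr s"
  shows "recorded s'"
  using assms by (simp add: recorded_def found_def)

lemma row_value:
  assumes "loaded s" "p \<in> {1..<L}" "\<And>k. k < dim env \<Longrightarrow> rarr s 0 k = \<rho> k"
  shows "(\<Sum>k<dim env. rarr s p k * rarr s 0 k) - rarr s p (dim env) = pair_value env \<rho> (\<pi> p)"
  using assms by (simp add: loaded_def pair_value_def)

lemma runs_report_recorded:
  assumes "loaded s" "recorded s" "nreg s rQ \<in> {1..<L}" "nreg s rQ \<notin> found s" "\<pi> (nreg s rQ) \<in> attained env n P"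
  shows "runs env report s (\<lambda>t s'. t = 7 \<and> loaded s' \<and> recorded s' \<and> nreg s' rCnt = Suc (nreg s rCnt) \<and>
    nreg s' rP = nreg s rP \<and> found s \<subseteq> found s')"
proof (rule runs_mono[OF runs_report[of n "dim env"]])
  show "consts_ok n (dim env) s" using assms(1) by (simp add: loaded_def)
next
  fix t :: nat and s' :: state
  assume *: "t = 7 \<and>
    (\<forall>r. r \<notin> {rT, rCnt} \<longrightarrow> nreg s' r = nreg s r) \<and> nreg s' rCnt = nreg s rCnt + 1 \<and>
    rreg s' = rreg s \<and> rarr s' = rarr s \<and> narr s' 2 = narr s 2 \<and> narr s' 3 = narr s 3 \<and>
    narr s' 0 = (narr s 0)(nreg s rCnt := narr s 2 (nreg s rQ)) \<and>
    narr s' 1 = (narr s 1)(nreg s rCnt := narr s 3 (nreg s rQ)) \<and>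
    narr s' 4 = (narr s 4)(nreg s rQ := 1) \<and>
    narr s' 5 = (narr s 5)(nreg s rCnt := nreg s rQ)"
  have found': "found s' = insert (nreg s rQ) (found s)"
    using * by (auto simp: found_def lessThan_Suc)
  have "loaded s'" using assms(1) by (rule loaded_cong) (use * in auto)
  moreover have "recorded s'"
    unfolding recorded_def
  proof (intro conjI)
    show "inj_on (narr s' 5) {..<nreg s' rCnt}"
      using * assms(2,4) by (auto simp: recorded_def lessThan_Suc found_def inj_on_def) (metis imageI lessThan_iff)
    show "\<forall>p\<in>{1..<L}. (0 < narr s' 4 p) = (p \<in> found s')"
      using * assms(2) by (auto simp: recorded_def found')
    show "\<forall>r<nreg s' rCnt. narr s' 5 r \<in> {1..<L} \<and> \<pi> (narr s' 5 r) \<in> attained env n P \<and>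
        narr s' 0 r = fst (\<pi> (narr s' 5 r)) \<and> narr s' 1 r = snd (\<pi> (narr s' 5 r))"
      using * assms by (auto simp: recorded_def loaded_def less_Suc_eq)
  qed
  ultimately show "t = 7 \<and> loaded s' \<and> recorded s' \<and> nreg s' rCnt = Suc (nreg s rCnt) \<and>
    nreg s' rP = nreg s rP \<and> found s \<subseteq> found s'"
    using * found' by auto
qed

text \<open>The minimiser is either the candidate itself, which is not yet found, or strictly below
  it at \<open>\<rho>\<close> and hence strictly below every found pair. In both cases it is new,
  and \<open>\<rho>\<close> witnesses that it is attained.\<close>

lemma runs_add_minimizer:
  assumes "loaded s" "recorded s" "nreg s rQ \<in> {1..<L}" "\<rho> \<in> P" "\<And>k. k < dim env \<Longrightarrow> rarr s 0 k = \<rho> k"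
    "nreg s rQ \<notin> found s" "\<And>p. p \<in> found s \<Longrightarrow> pair_value env \<rho> (\<pi> (nreg s rQ)) \<le> pair_value env \<rho> (\<pi> p)"
  shows "runs env add_minimizer s (\<lambda>t s'. t \<le> 12 * L * (dim env + 1) + 7 \<and> loaded s' \<and> recorded s' \<and>
    nreg s' rCnt = Suc (nreg s rCnt) \<and> nreg s' rP = nreg s rP \<and> found s \<subseteq> found s')"
  apply (simp only: add_minimizer_def block.simps runs_Seq)
  apply (rule runs_mono[OF runs_minimize[of n "dim env" _ L "\<lambda>p. pair_value env \<rho> (\<pi> p)"]])
  subgoal using assms by (simp add: loaded_def)
  subgoal using assms by (simp add: loaded_def)
  subgoal using assms by simp
  subgoal using assms by (intro row_value)
  subgoal for t s'
    apply (subgoal_tac "found s' = found s")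
    apply (rule runs_mono[OF runs_report_recorded])
    subgoal by (rule loaded_cong[OF assms(1)]) auto
    subgoal by (rule recorded_cong[OF assms(2)]) auto
    subgoal by simp
    subgoal using assms(6,7) by force
    subgoal
    proof -
      assume a: "t \<le> 12 * L * (dim env + 1) \<and>
    (\<forall>r. r \<notin> {rK, rU, rQ} \<longrightarrow> nreg s' r = nreg s r) \<and> narr s' = narr s \<and> rarr s' = rarr s \<and>
    nreg s' rQ \<in> {1..<L} \<and> (\<forall>p\<in>{1..<L}. pair_value env \<rho> (\<pi> (nreg s' rQ)) \<le> pair_value env \<rho> (\<pi> p)) \<and>
    (nreg s' rQ = nreg s rQ \<or> pair_value env \<rho> (\<pi> (nreg s' rQ)) < pair_value env \<rho> (\<pi> (nreg s rQ))) \<and>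
    (\<forall>x. x \<notin> {xAcc, xA, xB, xBest} \<longrightarrow> rreg s' x = rreg s x)"
      have "\<forall>u\<in>verts n. pair_value env \<rho> (\<pi> (nreg s' rQ)) \<le> pair_value env \<rho> u"
        using a bij_betw_imp_surj_on[OF bij] by (metis imageE)
      then show ?thesis using a pi_verts[of "nreg s' rQ"] assms(4) by (auto simp: attained_def)
    qed
    subgoal by auto
    subgoal by (simp add: found_def)
    done
  done


text \<open>Carries \<open>solve_rows\<close> over to machine states. The two implications about the
  optimal point leave the sign test to \<open>judge\<close>.\<close>

lemma runs_pose:
  assumes s: "loaded s" "recorded s" "0 < nreg s rCnt" "nreg s rP \<in> {1..<L}"
  shows "runs env pose s (\<lambda>t s'.
    t \<le> 12 * nreg s rCnt * (dim env + 1) + 4 + solve_cost env (dim env) (nreg s rCnt - 1) \<and>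
    loaded s' \<and> recorded s' \<and> found s' = found s \<and> nreg s' rP = nreg s rP \<and> nreg s' rCnt = nreg s rCnt \<and>
    (nreg s' rG = 0 \<and> \<pi> (nreg s rP) \<notin> attained env n P \<or>
     nreg s' rG = 1 \<and> (\<exists>x\<in>P. (\<forall>k<dim env. rarr s' 0 k = x k) \<and>
      (pair_value env x (\<pi> (narr s' 5 0)) < pair_value env x (\<pi> (nreg s rP)) \<longrightarrow>
         \<pi> (nreg s rP) \<notin> attained env n P) \<and>
      (pair_value env x (\<pi> (nreg s rP)) \<le> pair_value env x (\<pi> (narr s' 5 0)) \<longrightarrow>
         (\<forall>q\<in>found s. pair_value env x (\<pi> (nreg s rP)) \<le> pair_value env x (\<pi> q))))))"
proof -
  have w: "narr s 5 r \<in> {1..<L}" if "r < nreg s rCnt" for r using s(2) that by (auto simp: recorded_def)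
  have co: "consts_ok n (dim env) s" "nreg s rTop = L" using s by (auto simp: loaded_def)
  note regs = co[unfolded consts_ok_def]
  have L: "0 < L" using s(4) by auto
  show ?thesis
    unfolding pose_def block.simps runs_Seq
  proof (rule runs_mono[OF runs_build_rows[of n "dim env" _ L]])
    show "consts_ok n (dim env) s" "nreg s rTop = L" "nreg s rP \<in> {1..<L}"
      "\<And>r. r < nreg s rCnt \<Longrightarrow> narr s 5 r < L"
      using co s(4) w by auto
  next
    fix t1 and s1 :: state
    assume *: "t1 \<le> 12 * nreg s rCnt * (dim env + 1) + 2 \<and>
      (\<forall>r. r \<notin> {rK, rR, rT, rA} \<longrightarrow> nreg s1 r = nreg s r) \<and> narr s1 = narr s \<and>
      (\<forall>a<L. rarr s1 a = rarr s a) \<and>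
      (\<forall>r<nreg s rCnt. \<forall>k\<le>dim env. rarr s1 (L + r) k = rarr s (nreg s rP) k - rarr s (narr s 5 r) k) \<and>
      (\<forall>x. x \<notin> {xA, xB} \<longrightarrow> rreg s1 x = rreg s x)"
    let ?R = "\<lambda>r. rarr s1 (L + r)"
    let ?sol = "solve env (nreg s rCnt - 1) (?R 0) (\<lambda>i. ?R (Suc i))"
    have rows: "?R r k = coef env (\<pi> (nreg s rP)) k - coef env (\<pi> (narr s 5 r)) k"
      if "r < nreg s rCnt" "k \<le> dim env" for r k
      using * s(1,4) w that by (simp add: loaded_def)
    note sr = solve_rows[OF lp s(3) pi_verts[OF s(4)], of "\<lambda>r. \<pi> (narr s 5 r)" ?R]
    have none: "\<pi> (nreg s rP) \<notin> attained env n P" if "?sol = None"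
      by (rule sr(1)) (use w rows pi_verts that in auto)
    have some: "x \<in> P" if "?sol = Some x" for x
      by (rule sr(2)) (use w rows pi_verts that in auto)
    have above: "\<pi> (nreg s rP) \<notin> attained env n P"
      if "?sol = Some x" "pair_value env x (\<pi> (narr s 5 0)) < pair_value env x (\<pi> (nreg s rP))" for x
      by (rule sr(3)) (use w rows pi_verts that in auto)
    have below: "pair_value env x (\<pi> (nreg s rP)) \<le> pair_value env x (\<pi> (narr s 5 r))"
      if "?sol = Some x" "pair_value env x (\<pi> (nreg s rP)) \<le> pair_value env x (\<pi> (narr s 5 0))"
        "r < nreg s rCnt" for x r
      by (rule sr(4)) (use w rows pi_verts that in auto)
    let ?s2 = "s1\<lparr>nreg := (nreg s1)(rA := L + 1, rT := nreg s rCnt - 1)\<rparr>"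
    let ?s3 = "effect env (Solve rG rTop rA rT rZero) ?s2"
    have eff: "?s3 = (case ?sol of None \<Rightarrow> ?s2\<lparr>nreg := (nreg ?s2)(rG := 0)\<rparr>
      | Some x \<Rightarrow> ?s2\<lparr>nreg := (nreg ?s2)(rG := 1),
          rarr := (rarr s1)(0 := (\<lambda>k. if k < dim env then x k else rarr s1 0 k))\<rparr>)"
      using * regs by (simp split: option.split cong: if_cong)
    have eff3: "nreg ?s3 r = nreg s r" if "r \<notin> {rK, rR, rT, rA, rG}" for r
      using * that unfolding eff by (auto split: option.split)
    \<comment> \<open>The solution overwrites only array 0 and the new rows lie from
      \<open>L\<close> on, so the table is unchanged.\<close>
    have eff4: "narr ?s3 = narr s" "rreg ?s3 = rreg s1" "\<And>a. 0 < a \<Longrightarrow> a < L \<Longrightarrow> rarr ?s3 a = rarr s a"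
      using * unfolding eff by (auto split: option.split)
    have "loaded ?s3"
      using s(1) by (rule loaded_cong) (use * eff3 eff4 in auto)
    moreover have "recorded ?s3"
      using s(2) by (rule recorded_cong) (use eff3 eff4 in auto)
    moreover have "found ?s3 = found s"
      using eff3 eff4 by (simp add: found_def)
    moreover have "nreg ?s3 rG = 0 \<and> \<pi> (nreg s rP) \<notin> attained env n P \<or>
     nreg ?s3 rG = 1 \<and> (\<exists>x\<in>P. (\<forall>k<dim env. rarr ?s3 0 k = x k) \<and>
      (pair_value env x (\<pi> (narr ?s3 5 0)) < pair_value env x (\<pi> (nreg s rP)) \<longrightarrow>
         \<pi> (nreg s rP) \<notin> attained env n P) \<and>
      (pair_value env x (\<pi> (nreg s rP)) \<le> pair_value env x (\<pi> (narr ?s3 5 0)) \<longrightarrow>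
         (\<forall>q\<in>found s. pair_value env x (\<pi> (nreg s rP)) \<le> pair_value env x (\<pi> q))))"
    proof (cases ?sol)
      case None
      then show ?thesis using none unfolding eff by simp
    next
      case (Some x)
      have "\<forall>k<dim env. rarr ?s3 0 k = x k" "nreg ?s3 rG = 1" unfolding eff Some by simp_all
      moreover have "\<forall>q\<in>found s. pair_value env x (\<pi> (nreg s rP)) \<le> pair_value env x (\<pi> q)"
        if "pair_value env x (\<pi> (nreg s rP)) \<le> pair_value env x (\<pi> (narr s 5 0))"
        using below[OF Some that] by (auto simp: found_def)
      ultimately show ?thesis using some[OF Some] above[OF Some] eff4(1) by auto
    qed
    ultimately show "runs env (Do (NAdd rA rTop rOne)) s1 (\<lambda>t2 s2. runs env (Do (NSub rT rCnt rOne)) s2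
       (\<lambda>t3 s3. runs env (Do (Solve rG rTop rA rT rZero)) s3 (\<lambda>t4 s'.
    t1 + (t2 + (t3 + t4)) \<le> 12 * nreg s rCnt * (dim env + 1) + 4 + solve_cost env (dim env) (nreg s rCnt - 1) \<and>
    loaded s' \<and> recorded s' \<and> found s' = found s \<and> nreg s' rP = nreg s rP \<and> nreg s' rCnt = nreg s rCnt \<and>
    (nreg s' rG = 0 \<and> \<pi> (nreg s rP) \<notin> attained env n P \<or>
     nreg s' rG = 1 \<and> (\<exists>x\<in>P. (\<forall>k<dim env. rarr s' 0 k = x k) \<and>
      (pair_value env x (\<pi> (narr s' 5 0)) < pair_value env x (\<pi> (nreg s rP)) \<longrightarrow>
         \<pi> (nreg s rP) \<notin> attained env n P) \<and>
      (pair_value env x (\<pi> (nreg s rP)) \<le> pair_value env x (\<pi> (narr s' 5 0)) \<longrightarrow>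
         (\<forall>q\<in>found s. pair_value env x (\<pi> (nreg s rP)) \<le> pair_value env x (\<pi> q))))))))"
    proof -
      have s2: "effect env (NSub rT rCnt rOne) (effect env (NAdd rA rTop rOne) s1) = ?s2"
        using * regs by simp
      have c: "instr_cost env (Solve rG rTop rA rT rZero) ?s2 = solve_cost env (dim env) (nreg s rCnt - 1)"
        by simp
      show ?thesis
        unfolding runs_Do s2 c
        using * eff3[of rP] eff3[of rCnt] \<open>loaded ?s3\<close> \<open>recorded ?s3\<close> \<open>found ?s3 = found s\<close> \<open>nreg ?s3 rG = 0 \<and> _ \<or> _\<close>
        by (simp del: effect.simps)
    qed
  qed
qed

text \<open>The two kinds of progress are kept apart because their costs differ: a discard takes two
  evaluations, a report a minimum over all pairs.\<close>

lemma runs_judge: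
  assumes s: "loaded s" "recorded s" "0 < nreg s rCnt" "nreg s rP \<in> {1..<L}" "nreg s rP \<notin> found s"
    and G: "nreg s rG = 0 \<and> \<pi> (nreg s rP) \<notin> attained env n P \<or>
     nreg s rG = 1 \<and> (\<exists>x\<in>P. (\<forall>k<dim env. rarr s 0 k = x k) \<and>
      (pair_value env x (\<pi> (narr s 5 0)) < pair_value env x (\<pi> (nreg s rP)) \<longrightarrow>
         \<pi> (nreg s rP) \<notin> attained env n P) \<and>
      (pair_value env x (\<pi> (nreg s rP)) \<le> pair_value env x (\<pi> (narr s 5 0)) \<longrightarrow>
         (\<forall>q\<in>found s. pair_value env x (\<pi> (nreg s rP)) \<le> pair_value env x (\<pi> q))))"
  shows "runs env judge s (\<lambda>t s'. loaded s' \<and> recorded s' \<and> found s \<subseteq> found s' \<and>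
    (t \<le> 12 * (dim env + 1) + 5 \<and> nreg s' rP = Suc (nreg s rP) \<and> nreg s' rCnt = nreg s rCnt \<and>
       \<pi> (nreg s rP) \<notin> attained env n P \<or>
     t \<le> 12 * (dim env + 1) + 12 + 12 * L * (dim env + 1) \<and>
       nreg s' rP = nreg s rP \<and> nreg s' rCnt = Suc (nreg s rCnt)))"
proof -
  have co: "consts_ok n (dim env) s" "nreg s rTop = L" using s by (auto simp: loaded_def)
  note regs = co[unfolded consts_ok_def]
  have w: "narr s 5 0 \<in> {1..<L}" using s(2,3) by (auto simp: recorded_def)
  \<comment> \<open>A discard, and the steps of a report before its minimum, write only scratch
    registers and \<open>rP\<close>.\<close>
  have skip: "loaded s' \<and> recorded s' \<and> found s' = found s"
    if "\<And>r. r \<notin> {rK, rT, rP, rQ} \<Longrightarrow> nreg s' r = nreg s r" "rreg s' xZero = rreg s xZero"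
      "narr s' = narr s" "rarr s' = rarr s" for s'
  proof -
    have "loaded s'" using s(1) by (rule loaded_cong) (use that in auto)
    moreover have "recorded s'" using s(2) by (rule recorded_cong) (use that in auto)
    ultimately show ?thesis using that by (simp add: found_def)
  qed
  from G show ?thesis
  proof (elim disjE conjE bexE)
    assume "nreg s rG = 0" and out: "\<pi> (nreg s rP) \<notin> attained env n P"
    then show ?thesis
      unfolding judge_def using skip[of "s\<lparr>nreg := (nreg s)(rP := Suc (nreg s rP))\<rparr>"] by (simp add: regs)
  next
    fix x
    assume g: "nreg s rG = 1" and x: "x \<in> P" "\<forall>k<dim env. rarr s 0 k = x k"
      and out: "pair_value env x (\<pi> (narr s 5 0)) < pair_value env x (\<pi> (nreg s rP)) \<longrightarrow>
         \<pi> (nreg s rP) \<notin> attained env n P"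
      and below: "pair_value env x (\<pi> (nreg s rP)) \<le> pair_value env x (\<pi> (narr s 5 0)) \<longrightarrow>
         (\<forall>q\<in>found s. pair_value env x (\<pi> (nreg s rP)) \<le> pair_value env x (\<pi> q))"
    have val: "(\<Sum>k<dim env. rarr s p k * rarr s 0 k) - rarr s p (dim env) = pair_value env x (\<pi> p)"
      if "p \<in> {1..<L}" for p
      using row_value[OF s(1) that] x(2) by blast
    show ?thesis
      unfolding judge_def
      apply (simp add: regs g del: One_nat_def)
      apply (rule runs_mono[OF runs_evaluate[of _ "dim env"]])
      subgoal using regs by simp
      subgoal using regs by simp
      subgoal using regs by simp
      subgoal by simp
      subgoal for t1 s1
        apply (rule runs_mono[OF runs_evaluate[of _ "dim env"]])
        subgoal using regs by simp
        subgoal using regs by simp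
        subgoal using regs by simp
        subgoal by simp
        subgoal for t2 s2
          apply (cases "pair_value env x (\<pi> (narr s 5 0)) < pair_value env x (\<pi> (nreg s rP))")
          subgoal using out skip[of "s2\<lparr>nreg := (nreg s2)(rP := Suc (nreg s2 rP))\<rparr>"]
            by (simp add: val[OF w] val[OF s(4)] regs)
          subgoal
            using skip[of "s2\<lparr>nreg := (nreg s2)(rQ := nreg s rP)\<rparr>"]
            apply (clarsimp simp: val[OF w] val[OF s(4)] regs)
            apply (rule runs_mono[OF runs_add_minimizer[where \<rho> = x]])
            subgoal by simp
            subgoal by simp
            subgoal using s(4) by simp
            subgoal using x by simp
            subgoal using x by simp
            subgoal using s(5) by simp
            subgoal using below by simp
            subgoal by auto
            done
          done
        done
      done
  qed
qed

lemma runs_examine: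
  assumes s: "loaded s" "recorded s" "0 < nreg s rCnt" "nreg s rP \<in> {1..<L}"
    and LPE: "solve_cost env (dim env) (nreg s rCnt - 1) \<le> LPE"
  shows "runs env examine s (\<lambda>t s'. loaded s' \<and> recorded s' \<and> found s \<subseteq> found s' \<and>
    (t \<le> 50 * LPE \<and> nreg s' rP = Suc (nreg s rP) \<and> nreg s' rCnt = nreg s rCnt \<and>
       (nreg s rP \<in> found s' \<or> \<pi> (nreg s rP) \<notin> attained env n P) \<or>
     t \<le> 50 * LPE + 12 * L * (dim env + 1) \<and> nreg s' rP = nreg s rP \<and> nreg s' rCnt = Suc (nreg s rCnt)))"
proof -
  let ?d = "dim env" and ?cnt = "nreg s rCnt" and ?p = "nreg s rP"
  \<comment> \<open>The solver is charged at least for reading its tableau, which here has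
    \<open>rCnt\<close> rows counting the objective. This pays for building the rows, and 50 is a
    generous total.\<close>
  have "(?d + 1) * (?cnt - 1 + 1) \<le> solve_cost env ?d (?cnt - 1)"
    using cost unfolding lp_cost_function_def by blast
  then have C: "?cnt * (?d + 1) \<le> LPE" using LPE s(3) by (simp add: mult.commute)
  then have C1: "?d + 1 \<le> LPE" using s(3) by (metis One_nat_def Suc_leI le_trans mult_le_mono1 nat_mult_1)
  have flag: "0 < narr s 4 ?p \<longleftrightarrow> ?p \<in> found s" using s by (simp add: recorded_def)
  have co: "consts_ok n ?d s" "nreg s rTop = L" using s by (auto simp: loaded_def)
  note regs = co[unfolded consts_ok_def]
  show ?thesis
  proof (cases "?p \<in> found s")
    case True
    then have f: "0 < narr s 4 ?p" using flag by simp
    let ?s' = "s\<lparr>nreg := (nreg s)(rT := narr s 4 ?p, rP := Suc ?p)\<rparr>"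
    have "loaded ?s'" by (rule loaded_cong[OF s(1)]) auto
    moreover have "recorded ?s'" by (rule recorded_cong[OF s(2)]) auto
    moreover have "found ?s' = found s" by (simp add: found_def)
    ultimately show ?thesis
      unfolding examine_def using f True C1 by (simp add: regs)
  next
    case False
    then have f: "narr s 4 ?p = 0" using flag by simp
    let ?s' = "s\<lparr>nreg := (nreg s)(rT := 0)\<rparr>"
    have l: "loaded ?s'" by (rule loaded_cong[OF s(1)]) auto
    have r: "recorded ?s'" by (rule recorded_cong[OF s(2)]) auto
    have f': "found ?s' = found s" by (simp add: found_def)
    show ?thesis
      unfolding examine_def
      apply (simp add: regs f)
      apply (rule runs_mono[OF runs_pose[OF l r]])
      subgoal using s(3) by simp
      subgoal using s(4) by simp
      subgoal for t1 s1
        apply (rule runs_mono[OF runs_judge])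
        subgoal by simp
        subgoal by simp
        subgoal using s(3) by simp
        subgoal using s(4) by simp
        subgoal using False by (simp add: f')
        subgoal by simp
        subgoal for t2 s2 using LPE C C1 by (auto simp: f')
        done
      done
  qed
qed

lemma finite_attained: "finite (attained env n P)"
  using bij_betw_finite[OF bij] by (simp add: attained_def)

text \<open>The list of numbers and \<open>\<pi>\<close> are both injective, so the entries are
  distinct attained pairs. The bound serves twice: it limits the constraints of each program and the
  number of reports.\<close>

lemma recorded_card:
  assumes "recorded s"
  shows "nreg s rCnt \<le> card (attained env n P)"
proof -
  have "inj_on \<pi> (found s)"
    using bij assms by (intro inj_on_subset[OF bij_betw_imp_inj_on[OF bij]]) (auto simp: recorded_def found_def)
  then have "inj_on (\<lambda>r. \<pi> (narr s 5 r)) {..<nreg s rCnt}"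
    using assms comp_inj_on[of "narr s 5" "{..<nreg s rCnt}" \<pi>]
    by (simp add: recorded_def found_def comp_def)
  moreover have "(\<lambda>r. \<pi> (narr s 5 r)) ` {..<nreg s rCnt} \<subseteq> attained env n P"
    using assms by (auto simp: recorded_def)
  ultimately show ?thesis using card_inj_on_le[OF _ _ finite_attained] by fastforce
qed

lemma recorded_result:
  assumes "recorded s"
  shows "{(narr s 0 r, narr s 1 r) | r. r < nreg s rCnt} = \<pi> ` found s"
proof -
  have "(narr s 0 r, narr s 1 r) = \<pi> (narr s 5 r)" if "r < nreg s rCnt" for r
    using assms that by (simp add: recorded_def prod_eq_iff)
  then show ?thesis unfolding found_def image_image setcompr_eq_image by (intro image_cong) auto
qed

text \<open>Every round advances \<open>rP\<close> or raises \<open>rCnt\<close>, and the potential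
  has one term for each. As \<open>found\<close> only grows, a number that \<open>rP\<close> has
  passed stays settled, and at the end all numbers are settled.\<close>

lemma runs_examine_all:
  assumes s: "loaded s" "recorded s" "0 < nreg s rCnt" "nreg s rP = 1" "1 \<le> L"
    and E: "card (attained env n P) \<le> E + 1" and V: "V = card (attained env n P)"
    and LPE: "LPE = solve_cost env (dim env) E"
  shows "runs env (While (NLess rP rTop) examine) s (\<lambda>t s'.
    t \<le> (L - 1) * (50 * LPE + 1) + (V - nreg s rCnt) * (50 * LPE + 12 * L * (dim env + 1) + 1) + 1 \<and>
    nreg s' rZero = 0 \<and>
    {(narr s' 0 r, narr s' 1 r) | r. r < nreg s' rCnt} = attained env n P)"
proof (rule runs_While[where \<Phi> = "\<lambda>s'. (L - nreg s' rP) * (50 * LPE + 1) +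
      (V - nreg s' rCnt) * (50 * LPE + 12 * L * (dim env + 1) + 1)"
    and I = "\<lambda>s'. loaded s' \<and> recorded s' \<and> 0 < nreg s' rCnt \<and> 1 \<le> nreg s' rP \<and> nreg s' rP \<le> L \<and>
      (\<forall>p. 1 \<le> p \<and> p < nreg s' rP \<longrightarrow> p \<in> found s' \<or> \<pi> p \<notin> attained env n P)"], goal_cases)
  case 1
  then show ?case using s by simp
next
  case (2 s)
  then have P: "nreg s rP \<in> {1..<L}" by (auto simp: loaded_def)
  \<comment> \<open>The assumption on \<open>E\<close>, which comes from connectedness, limits the
    size of the program; monotonicity of the cost does the rest.\<close>
  have "nreg s rCnt - 1 \<le> E" using recorded_card[of s] 2 E by linarith
  then have L: "solve_cost env (dim env) (nreg s rCnt - 1) \<le> LPE"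
    using cost unfolding lp_cost_function_def LPE by (blast dest: monoD)
  show ?case
  proof (rule runs_mono[OF runs_examine[OF _ _ _ P L]], goal_cases)
    case (4 t s')
    show ?case
    proof (cases "nreg s' rCnt = nreg s rCnt")
      case True
      then have 5: "nreg s' rP = Suc (nreg s rP)" "t \<le> 50 * LPE"
          "nreg s rP \<in> found s' \<or> \<pi> (nreg s rP) \<notin> attained env n P" "found s \<subseteq> found s'"
          "loaded s'" "recorded s'"
        using 4 by auto
      have past: "p \<in> found s' \<or> \<pi> p \<notin> attained env n P" if "1 \<le> p" "p < Suc (nreg s rP)" for p
        using that 5 2 by (cases "p = nreg s rP") (auto simp: less_Suc_eq)
      have time: "t + 1 + ((L - nreg s' rP) * (50 * LPE + 1) +
          (V - nreg s' rCnt) * (50 * LPE + 12 * L * (dim env + 1) + 1))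
        \<le> (L - nreg s rP) * (50 * LPE + 1) + (V - nreg s rCnt) * (50 * LPE + 12 * L * (dim env + 1) + 1)"
      proof -
        have "nreg s rP < L" using P by simp
        then show ?thesis using 5(2) unfolding 5(1) True countdown[OF \<open>nreg s rP < L\<close>] by linarith
      qed
      show ?thesis by (intro conjI time) (use 2 5(1,5,6) True P past in simp_all)
    next
      case False
      then have 5: "nreg s' rP = nreg s rP" "t \<le> 50 * LPE + 12 * L * (dim env + 1)"
          "nreg s' rCnt = Suc (nreg s rCnt)" "found s \<subseteq> found s'" "loaded s'" "recorded s'"
        using 4 by auto
      \<comment> \<open>The bound applied to the state after the report shows that there was still
        room before it, so the truncated difference really drops.\<close>
      have "nreg s rCnt < V" using recorded_card[OF 5(6)] 5(3) V by simp
      have time: "t + 1 + ((L - nreg s' rP) * (50 * LPE + 1) +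
          (V - nreg s' rCnt) * (50 * LPE + 12 * L * (dim env + 1) + 1))
        \<le> (L - nreg s rP) * (50 * LPE + 1) + (V - nreg s rCnt) * (50 * LPE + 12 * L * (dim env + 1) + 1)"
        using 5(2) unfolding 5(1,3) countdown[OF \<open>nreg s rCnt < V\<close>] by linarith
      have past: "p \<in> found s' \<or> \<pi> p \<notin> attained env n P" if "1 \<le> p" "p < nreg s rP" for p
        using that 5(4) 2(1) by blast
      show ?thesis by (intro conjI time) (use 2 5(1,3,5,6) past in simp_all)
    qed
  qed (use 2 in auto)
next
  case (3 t s')
  then have rP: "nreg s' rP = L" "loaded s'" "recorded s'" by (auto simp: loaded_def)
  have "attained env n P \<subseteq> \<pi> ` found s'"
  proof
    fix v assume v: "v \<in> attained env n P"
    then have "v \<in> \<pi> ` {1..<L}" using bij by (auto simp: attained_def bij_betw_def)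
    then show "v \<in> \<pi> ` found s'" using 3 v rP(1) by auto
  qed
  moreover have "\<pi> ` found s' \<subseteq> attained env n P" using rP(3) by (auto simp: recorded_def found_def)
  ultimately have "{(narr s' 0 r, narr s' 1 r) | r. r < nreg s' rCnt} = attained env n P"
    using recorded_result[OF rP(3)] by simp
  then show ?case using 3(3) rP(2) s(4) by (simp add: loaded_def consts_ok_def)
qed

end

section \<open>Total running time\<close>

text \<open>The table fits into the second term because \<open>1 \<le> V\<close>. A minimum over all
  pairs costs a multiple of \<open>n\<^sup>2 * K\<close>, by \<open>L \<le> n\<^sup>2\<close> and
  \<open>2 * (d + 1) \<le> K\<close>, and is taken at most \<open>V\<close> times. The programs
  solved in rounds that report fit into the first term because
  \<open>V \<le> n\<^sup>2\<close>.\<close>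

lemma total_time:
  fixes n L d K V LPE :: nat
  assumes "1 \<le> n" "1 \<le> V" "V \<le> n\<^sup>2" "L \<le> n\<^sup>2" "2 * (d + 1) \<le> K" "1 \<le> LPE"
    and "t1 \<le> 9 + LPE" "t2 \<le> n * ((n - 1) * (2 * K + 5) + 4) + 3" "t3 \<le> 12 * L * (d + 1) + 7"
    and t4: "t4 \<le> (L - 1) * (50 * LPE + 1) + (V - 1) * (50 * LPE + 12 * L * (d + 1) + 1) + 1"
  shows "t1 + t2 + t3 + t4 + 5 \<le> 200 * (n\<^sup>2 * LPE + V * n\<^sup>2 * K)"
proof -
  let ?X = "n\<^sup>2 * LPE" and ?Y = "V * n\<^sup>2 * K"
  have n2: "1 \<le> n\<^sup>2" "n \<le> n\<^sup>2" using assms(1) by (auto simp: power2_eq_square)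
  have X: "n\<^sup>2 \<le> ?X" "LPE \<le> ?X" using assms(6) n2 by auto
  have Y: "n\<^sup>2 * K \<le> ?Y" using assms(2) by simp
  have "12 * L * (d + 1) = 6 * (L * (2 * (d + 1)))" by simp
  also have "\<dots> \<le> 6 * (n\<^sup>2 * K)" using assms(4,5) by (intro mult_le_mono) auto
  finally have Ld: "12 * L * (d + 1) \<le> 6 * (n\<^sup>2 * K)" .
  have "n * ((n - 1) * (2 * K + 5) + 4) \<le> n * (n * (2 * K + 5)) + n * 4"
    unfolding distrib_left by (intro add_mono mult_le_mono) auto
  also have "\<dots> = 2 * (n\<^sup>2 * K) + 5 * n\<^sup>2 + 4 * n" by (simp add: power2_eq_square algebra_simps)
  finally have t2: "t2 \<le> 2 * ?Y + 12 * ?X"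
    using assms(8) Y X n2 by linarith
  have "(L - 1) * (50 * LPE + 1) \<le> n\<^sup>2 * (50 * LPE + 1)" using assms(4) by (intro mult_le_mono) auto
  also have "\<dots> \<le> 51 * ?X" using X by (simp add: algebra_simps)
  finally have a: "(L - 1) * (50 * LPE + 1) \<le> 51 * ?X" .
  have "(V - 1) * (50 * LPE + 12 * L * (d + 1) + 1) \<le> V * (50 * LPE + 6 * (n\<^sup>2 * K) + 1)"
    using Ld by (intro mult_le_mono) auto
  also have "\<dots> = V * (50 * LPE + 1) + 6 * ?Y" by (simp add: algebra_simps)
  also have "\<dots> \<le> n\<^sup>2 * (50 * LPE + 1) + 6 * ?Y" using assms(3) by (intro add_mono mult_le_mono) auto
  also have "\<dots> \<le> 51 * ?X + 6 * ?Y" using X by (simp add: algebra_simps)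
  finally have "t4 \<le> 103 * ?X + 6 * ?Y" using t4 a X n2 by linarith
  moreover have "t1 \<le> 10 * ?X" using assms(7) X n2(1) by linarith
  moreover have "t3 + 5 \<le> 6 * ?Y + 12 * ?X" using assms(9) Ld Y X(1) n2(1) by linarith
  ultimately show ?thesis using t2 by simp
qed

lemma card_verts: "finite (verts n)" "1 \<le> n \<Longrightarrow> card (verts n) + 1 \<le> n\<^sup>2"
proof -
  \<comment> \<open>Leaving out one diagonal pair gains the 1 that is needed for
    \<open>L \<le> n\<^sup>2\<close>, where \<open>L\<close> exceeds the number of pairs by
    one.\<close>
  have sub: "verts n \<subseteq> {..<n} \<times> {..<n} - {(0, 0)}" by (auto simp: verts_def)
  then show "finite (verts n)" by (rule finite_subset) simp
  assume n: "1 \<le> n"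
  have "card (verts n) \<le> card ({..<n} \<times> {..<n} - {(0::nat, 0::nat)})" by (rule card_mono[OF _ sub]) simp
  also have "\<dots> = n\<^sup>2 - 1" using n by (subst card_Diff_singleton) (auto simp: power2_eq_square)
  finally show "card (verts n) + 1 \<le> n\<^sup>2" using n by (simp add: Suc_leI le_diff_conv2)
qed

lemma runs_initialize:
  assumes lp: "lp_solver (dim env) P (solve env)"
  shows "runs env initialize (init_state n (dim env)) (\<lambda>t s.
    t = 8 + solve_cost env (dim env) 0 \<and> consts_ok n (dim env) s \<and> narr s = (\<lambda>_ _. 0) \<and> nreg s rCnt = 0 \<and>
    (nreg s rG = 0 \<and> P = {} \<or> nreg s rG = 1 \<and> (\<exists>x\<in>P. \<forall>k<dim env. rarr s 0 k = x k)))"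
proof -
  \<comment> \<open>Without constraints the feasible set is \<open>P\<close>, so the answer decides
    emptiness.\<close>
  have sol: "case solve env 0 (\<lambda>_. 0) (\<lambda>_ _. 0) of None \<Rightarrow> P = {} | Some x \<Rightarrow> x \<in> P"
    using lp[unfolded lp_solver_def, rule_format, of 0 "\<lambda>_ _. 0" "\<lambda>_. 0"]
    by (auto simp: lp_feasible_def split: option.splits)
  let ?s = "(init_state n (dim env))\<lparr>nreg := (\<lambda>_. 0)(0 := n, 1 := dim env, rOne := 1, rDim := dim env,
    rDim1 := dim env + 1, rNum := n, rTwo := 2, rThree := 3, rFour := 4, rFive := 5)\<rparr>"
  have s: "effect env (NConst rFive 5) (effect env (NConst rFour 4) (effect env (NConst rThree 3)
      (effect env (NConst rTwo 2) (effect env (NAdd rNum 0 rZero) (effect env (NAdd rDim1 1 rOne)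
      (effect env (NAdd rDim 1 rZero) (effect env (NConst rOne 1) (init_state n (dim env))))))))) = ?s"
    by (simp add: init_state_def)
  have sol: "case solve env 0 (rarr ?s 0) (\<lambda>i. rarr ?s (0 + i)) of None \<Rightarrow> P = {} | Some x \<Rightarrow> x \<in> P"
    using sol by (simp add: init_state_def)
  show ?thesis
    unfolding initialize_def block.simps runs_Seq runs_Do s
    using sol by (auto simp: init_state_def consts_ok_def split: option.splits)
qed

lemma runs_find_vertices:
  assumes n: "1 \<le> n" and lp: "lp_solver (dim env) P (solve env)" and cost: "lp_cost_function (solve_cost env)"
    and K: "\<And>i j. i < j \<Longrightarrow> j < n \<Longrightarrow> (\<Sum>k<dim env + 1. base_cost env k i j + 2) \<le> K"
    and E: "card (attained env n P) \<le> E + 1"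
  shows "runs env find_vertices (init_state n (dim env)) (\<lambda>t s. result s = attained env n P \<and>
    t \<le> 200 * (n\<^sup>2 * solve_cost env (dim env) E + card (attained env n P) * n\<^sup>2 * K))"
proof -
  let ?d = "dim env" and ?V = "card (attained env n P)" and ?LPE = "solve_cost env (dim env) E"
  let ?B = "200 * (n\<^sup>2 * ?LPE + ?V * n\<^sup>2 * K)"
  have "mono (solve_cost env ?d)" "(?d + 1) * (E + 1) \<le> ?LPE"
    using cost unfolding lp_cost_function_def by blast+
  then have L: "solve_cost env ?d 0 \<le> ?LPE" "1 \<le> ?LPE" by (auto dest: monoD)
  \<comment> \<open>This budget is for the branches without a search, where no pair is attained and
    only the first term of the bound is left.\<close>
  have "1 * ?LPE \<le> n\<^sup>2 * ?LPE" using n by (intro mult_le_mono) auto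
  then have "25 + ?LPE \<le> 200 * (n\<^sup>2 * ?LPE)" using L(2) by linarith
  then have small: "25 + ?LPE \<le> ?B" by simp
  show ?thesis
    unfolding find_vertices_def block.simps runs_Seq
  proof (rule runs_mono[OF runs_initialize[OF lp]])
    fix t1 and s1 :: state
    assume 1: "t1 = 8 + solve_cost env (dim env) 0 \<and> consts_ok n (dim env) s1 \<and> narr s1 = (\<lambda>_ _. 0) \<and> nreg s1 rCnt = 0 \<and>
      (nreg s1 rG = 0 \<and> P = {} \<or> nreg s1 rG = 1 \<and> (\<exists>x\<in>P. \<forall>k<dim env. rarr s1 0 k = x k))"
    then have co: "nreg s1 rZero = 0" "nreg s1 rOne = 1" by (auto simp: consts_ok_def)
    \<comment> \<open>The last unit is for copying \<open>rCnt\<close> to register 0, which adds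
      \<open>rZero\<close> and so needs it to be 0.\<close>
    let ?Q = "\<lambda>t s. nreg s rZero = 0 \<and> {(narr s 0 r, narr s 1 r) | r. r < nreg s rCnt} = attained env n P \<and>
        t1 + t + 1 \<le> ?B"
    have "runs env (Cond (NLess rZero rG) (block
        [tabulate,
         Cond (NLess rOne rTop) (block
           [Do (NConst rQ 1), add_minimizer, Do (NConst rP 1), While (NLess rP rTop) examine])
           Skip])
        Skip) s1 ?Q"
    proof (cases "nreg s1 rG = 0")
      case True
      then have "attained env n P = {}" using 1 by (auto simp: attained_def)
      then show ?thesis using True 1 co small L by simp
    next
      case False
      then obtain x where x: "x \<in> P" "\<forall>k<dim env. rarr s1 0 k = x k" and g: "nreg s1 rG = 1" using 1 by auto
      have "runs env tabulate s1 (\<lambda>t2 s2. runs env (Cond (NLess rOne rTop) (block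
           [Do (NConst rQ 1), add_minimizer, Do (NConst rP 1), While (NLess rP rTop) examine])
           Skip) s2 (\<lambda>t s'. ?Q (1 + (t2 + t)) s'))"
      proof (rule runs_mono[OF runs_tabulate[of n]])
        show "consts_ok n (dim env) s1" using 1 by simp
        show "\<And>i j. i < j \<Longrightarrow> j < n \<Longrightarrow> (\<Sum>k<dim env + 1. base_cost env k i j + 2) \<le> K" by (rule K)
        fix t2 and s2 :: state
        assume 2: "t2 \<le> n * ((n - 1) * (2 * K + 5) + 4) + 3 \<and> outside_table s1 s2 \<and> tabulated env n 0 s2"
        define L \<pi> where L_def: "L = nreg s2 rTop" and \<pi>_def: "\<pi> = (\<lambda>p. (narr s2 2 p, narr s2 3 p))"
        have bij: "bij_betw \<pi> {1..<L} (verts n)" and L1: "1 \<le> L"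
          and rows: "\<forall>p\<in>{1..<L}. \<forall>k\<le>dim env. rarr s2 p k = coef env (\<pi> p) k"
          using 2 by (auto simp: tabulated_def L_def \<pi>_def)
        have card: "card (verts n) = L - 1" using bij_betw_same_card[OF bij] by simp
        interpret search env n P L \<pi> using bij lp cost by unfold_locales
        have co2: "consts_ok n (dim env) s2" "narr s2 0 = (\<lambda>_. 0)" "nreg s2 rCnt = 0" "narr s2 4 = (\<lambda>_. 0)"
          "rarr s2 0 = rarr s1 0"
          using 1 2 by (auto simp: consts_ok_def outside_table_def)
        show "runs env (Cond (NLess rOne rTop) (block
           [Do (NConst rQ 1), add_minimizer, Do (NConst rP 1), While (NLess rP rTop) examine])
           Skip) s2 (\<lambda>t s'. ?Q (1 + (t2 + t)) s')"
        proof (cases "1 < L")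
          case False
          then have v: "verts n = {}" using card card_verts(1)[of n] by simp
          \<comment> \<open>With a single cluster the table is empty and tabulating takes at most 7
            units, so no term with \<open>K\<close> is needed.\<close>
          have "n = 1"
          proof (rule ccontr)
            assume "n \<noteq> 1"
            then have "(0, 1) \<in> verts n" using n by (simp add: verts_def)
            then show False using v by simp
          qed
          moreover have "attained env n P = {}" using v by (simp add: attained_def)
          ultimately show ?thesis
            using False 1 2 co2 small L by (simp add: consts_ok_def L_def)
        next
          case True
          let ?s3 = "s2\<lparr>nreg := (nreg s2)(rQ := 1)\<rparr>"
          have "loaded ?s3"
            using co2 rows unfolding loaded_def by (simp add: consts_ok_def L_def \<pi>_def)
          moreover have "recorded ?s3" using co2 by (simp add: recorded_def found_def)
          \<comment> \<open>Nothing is found yet, so pair 1 is trivially an admissible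
            candidate.\<close>
          ultimately have "runs env add_minimizer ?s3 (\<lambda>t3 s'. t3 \<le> 12 * L * (dim env + 1) + 7 \<and> loaded s' \<and> recorded s' \<and>
              nreg s' rCnt = Suc (nreg ?s3 rCnt) \<and> nreg s' rP = nreg ?s3 rP \<and> found ?s3 \<subseteq> found s')"
            by (rule runs_add_minimizer[where \<rho> = x]) (use True x co2 in \<open>auto simp: found_def\<close>)
          then have "runs env add_minimizer ?s3 (\<lambda>t3 s'. t3 \<le> 12 * L * (dim env + 1) + 7 \<and> loaded s' \<and> recorded s' \<and>
              nreg s' rCnt = 1)"
            by (rule runs_mono) (use co2 in auto)
          then have "runs env add_minimizer ?s3 (\<lambda>t3 s3. runs env (While (NLess rP rTop) examine)
              (s3\<lparr>nreg := (nreg s3)(rP := 1)\<rparr>) (\<lambda>t4 s'. ?Q (1 + (t2 + (1 + (1 + (t3 + (1 + t4)))))) s'))"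
          proof (rule runs_mono)
            fix t3 and s3 :: state
            assume 3: "t3 \<le> 12 * L * (dim env + 1) + 7 \<and> loaded s3 \<and> recorded s3 \<and> nreg s3 rCnt = 1"
            let ?s4 = "s3\<lparr>nreg := (nreg s3)(rP := 1)\<rparr>"
            have s4: "loaded ?s4" "recorded ?s4"
              by (rule loaded_cong[of s3], use 3 in auto) (rule recorded_cong[of s3], use 3 in auto)
            have V1: "1 \<le> ?V" using recorded_card[of s3] 3 by simp
            have V2: "?V \<le> n\<^sup>2" "L \<le> n\<^sup>2"
              using card_verts[of n] n card L1 card_mono[OF card_verts(1)[of n], of "attained env n P"]
              by (auto simp: attained_def)
            have "verts n \<noteq> {}" using True card by auto
            then obtain i j where ij: "i < j" "j < n" by (auto simp: verts_def)
            \<comment> \<open>Each summand of the merge time is at least 2, so \<open>K\<close>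
              dominates the dimension and pays for evaluating a stored row.\<close>
            have "(\<Sum>k<?d + 1. 2) \<le> (\<Sum>k<?d + 1. base_cost env k i j + 2)" by (intro sum_mono) simp
            then have dK: "2 * (?d + 1) \<le> K" using K[OF ij] by simp
            show "runs env (While (NLess rP rTop) examine) ?s4
              (\<lambda>t4 s'. ?Q (1 + (t2 + (1 + (1 + (t3 + (1 + t4)))))) s')"
            proof (rule runs_mono[OF runs_examine_all[OF s4 _ _ L1 E refl refl]])
              show "0 < nreg ?s4 rCnt" "nreg ?s4 rP = 1" using 3 by auto
              fix t4 and s' :: state
              assume 4: "t4 \<le> (L - 1) * (50 * ?LPE + 1) +
                (?V - nreg ?s4 rCnt) * (50 * ?LPE + 12 * L * (dim env + 1) + 1) + 1 \<and> nreg s' rZero = 0 \<and>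
                {(narr s' 0 r, narr s' 1 r) | r. r < nreg s' rCnt} = attained env n P"
              have "t1 + t2 + t3 + t4 + 5 \<le> ?B"
                by (rule total_time[OF n V1 V2 dK L(2)]) (use 1 2 3 4 L in auto)
              then show "?Q (1 + (t2 + (1 + (1 + (t3 + (1 + t4)))))) s'" using 4 by simp
            qed
          qed
          then show ?thesis using True co2 by (simp add: consts_ok_def L_def)
        qed
      qed
      then show ?thesis using g co by simp
    qed
    then show "runs env (Cond (NLess rZero rG) (Seq tabulate
         (Cond (NLess rOne rTop) (Seq (Do (NConst rQ 1)) (Seq add_minimizer (Seq (Do (NConst rP 1)) (While (NLess rP rTop) examine))))
           Skip))
        Skip) s1 (\<lambda>t2 s2. runs env (Do (NAdd 0 rCnt rZero)) s2 (\<lambda>t3 s. result s = attained env n P \<and> t1 + (t2 + t3) \<le> ?B))"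
      unfolding block.simps by (rule runs_mono) (simp add: result_def)
  qed
qed

section \<open>Regions and their adjacency graph\<close>

lemma sum_block: "(\<Sum>i<l. \<Sum>j<m. g (i * m + j)) = (\<Sum>k<l * m. g k)" for g :: "nat \<Rightarrow> 'a::comm_monoid_add"
proof -
  have "(\<Sum>j<m. g (i * m + j)) = sum g {i * m..<i * m + m}" for i
    using sum.shift_bounds_nat_ivl[of g 0 "i * m" m] by (simp add: atLeast0LessThan add.commute)
  then show ?thesis using sum.nat_group[of g m l] by simp
qed

text \<open>The last weight is 1 minus the sum of the others. Substituting it subtracts the last
  base value from every coefficient and leaves it as the constant term.\<close>

lemma interp_eq_pair_value:
  assumes "1 \<le> l" "1 \<le> m"
  shows "interp l m D \<delta> \<rho> (C i) (C j) = pair_value (linkage_env l m D \<delta> C \<kappa> lp LP) \<rho> (i, j)"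
proof -
  let ?d = "l * m - 1" and ?b = "\<lambda>k. D (k div m) (C i) (C j) (\<delta> (k mod m))"
  have d: "l * m = Suc ?d" using assms by simp
  have "interp l m D \<delta> \<rho> (C i) (C j) = (\<Sum>i'<l. \<Sum>j'<m. alpha ?d \<rho> (i' * m + j') * ?b (i' * m + j'))"
    unfolding interp_def using assms by (intro sum.cong) auto
  also have "\<dots> = (\<Sum>k<Suc ?d. alpha ?d \<rho> k * ?b k)"
    using sum_block[of "\<lambda>k. alpha ?d \<rho> k * ?b k" m l] d by simp
  also have "\<dots> = (\<Sum>k<?d. \<rho> k * ?b k) + (1 - (\<Sum>k<?d. \<rho> k)) * ?b ?d"
    by (simp add: alpha_def)
  also have "\<dots> = (\<Sum>k<?d. (?b k - ?b ?d) * \<rho> k) + ?b ?d"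
    by (simp add: algebra_simps sum_subtractf sum_distrib_left sum_distrib_right)
  also have "\<dots> = pair_value (linkage_env l m D \<delta> C \<kappa> lp LP) \<rho> (i, j)"
    by (simp add: pair_value_def coef_def linkage_env_def)
  finally show ?thesis .
qed

text \<open>Merge functions are symmetric on finite nonempty subsets of \<open>X\<close>; this makes
  current clusters qualify. That some cluster remains yields \<open>1 \<le> n\<close>.\<close>

lemma linkage_stage_clusters:
  assumes "linkage_stage M S \<C>" "S \<noteq> {}"
  shows "\<C> \<noteq> {} \<and> (\<forall>A\<in>\<C>. A \<noteq> {} \<and> A \<subseteq> S)"
  using assms by induction auto

section \<open>Connectedness of the region adjacency graph\<close>

lemma convex_polytope_segment:
  assumes "convex_polytope d P" "x \<in> P" "y \<in> P" "0 \<le> t" "t \<le> 1"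
  shows "(\<lambda>k. (1 - t) * x k + t * y k) \<in> P"
proof -
  obtain W where W: "finite W"
    "P = {(\<lambda>k. \<Sum>w\<in>W. u w * w k) | u. (\<forall>w\<in>W. 0 \<le> u w) \<and> sum u W = 1}"
    using assms(1) unfolding convex_polytope_def by blast
  obtain u v where u: "x = (\<lambda>k. \<Sum>w\<in>W. u w * w k)" "\<forall>w\<in>W. 0 \<le> u w" "sum u W = 1"
    and v: "y = (\<lambda>k. \<Sum>w\<in>W. v w * w k)" "\<forall>w\<in>W. 0 \<le> v w" "sum v W = 1"
    using assms(2,3) unfolding W(2) by blast
  let ?z = "\<lambda>w. (1 - t) * u w + t * v w"
  have "(\<lambda>k. (1 - t) * x k + t * y k) = (\<lambda>k. \<Sum>w\<in>W. ?z w * w k)"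
    unfolding u(1) v(1) by (simp add: sum_distrib_left distrib_right sum.distrib mult.assoc)
  moreover have "\<forall>w\<in>W. 0 \<le> ?z w" using u(2) v(2) assms(4,5) by simp
  moreover have "sum ?z W = 1" using u(3) v(3) by (simp add: sum.distrib sum_distrib_left[symmetric])
  ultimately show ?thesis unfolding W(2) by (intro CollectI exI[of _ ?z]) blast
qed

lemma finite_edges: "finite (edges n P f)"
proof -
  have "edges n P f \<subseteq> Pow (verts n)" unfolding edges_def by blast
  then show ?thesis using card_verts(1) finite_subset by blast
qed

text \<open>On a segment joining two regions, the parameters covered by the regions in \<open>A\<close> and those covered by
  the remaining ones are closed and exhaust the segment, so they meet.\<close>

lemma edge_across_cut:
  assumes P: "convex_polytope d P"
    and affine: "\<And>x y t v. g (\<lambda>k. (1 - t) * x k + t * y k) v = (1 - t) * g x v + t * (g y v :: real)"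
    and region: "\<And>v. v \<in> verts n \<Longrightarrow> region n P f v = {\<rho>\<in>P. \<forall>u\<in>verts n. g \<rho> v \<le> g \<rho> u}"
    and A: "A \<subseteq> nonempty_verts n P f" "A \<noteq> {}" "A \<noteq> nonempty_verts n P f"
  shows "\<exists>a\<in>A. \<exists>b\<in>nonempty_verts n P f - A. {a, b} \<in> edges n P f"
proof -
  let ?N = "nonempty_verts n P f"
  obtain a b where a: "a \<in> A" and b: "b \<in> ?N - A" using A by blast
  then obtain x y where x: "x \<in> region n P f a" and y: "y \<in> region n P f b"
    using A(1) unfolding nonempty_verts_def by blast
  define z where "z t = (\<lambda>k. (1 - t) * x k + t * y k)" for t
  define T where "T v = {t\<in>{0..1}. \<forall>u\<in>verts n. g (z t) v \<le> g (z t) u}" for v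
  have zP: "z t \<in> P" if "t \<in> {0..1}" for t
  proof -
    have "x \<in> P" "y \<in> P" using x y by (auto simp: region_def split: prod.splits)
    then show ?thesis unfolding z_def using that by (intro convex_polytope_segment[OF P]) auto
  qed
  have T: "t \<in> T v \<longleftrightarrow> t \<in> {0..1} \<and> z t \<in> region n P f v" if "v \<in> verts n" for t v
    using that zP by (auto simp: T_def region)
  have closed_T: "closed (T v)" for v
  proof -
    have "T v = {0..1} \<inter> (\<Inter>u\<in>verts n. {t. (1 - t) * g x v + t * g y v \<le> (1 - t) * g x u + t * g y u})"
      by (auto simp: T_def z_def affine)
    then show ?thesis by (auto intro!: closed_Int closed_INT closed_Collect_le continuous_intros)
  qed
  have N: "finite ?N" "?N \<subseteq> verts n"
    using card_verts(1) by (auto simp: nonempty_verts_def)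
  let ?U = "\<Union>v\<in>A. T v" and ?V = "\<Union>v\<in>?N - A. T v"
  have "closed ?U" "closed ?V"
    using N(1) A(1) closed_T by (auto intro!: closed_UN intro: finite_subset)
  moreover have "{0..1} \<subseteq> ?U \<union> ?V"
  proof
    fix t :: real assume t: "t \<in> {0..1}"
    have "verts n \<noteq> {}" using a A(1) N(2) by blast
    then obtain v where v: "v \<in> verts n" "\<forall>u\<in>verts n. g (z t) v \<le> g (z t) u"
      using card_verts(1)[of n] arg_min_if_finite[of "verts n" "g (z t)"] by (metis not_le_imp_less)
    then have "z t \<in> region n P f v" using zP[OF t] by (simp add: region)
    then have "v \<in> ?N" using v by (auto simp: nonempty_verts_def)
    moreover have "t \<in> T v" using v t by (simp add: T_def)
    ultimately show "t \<in> ?U \<union> ?V" by blast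
  qed
  moreover have "0 \<in> ?U" "1 \<in> ?V"
  proof -
    have "z 0 = x" "z 1 = y" by (auto simp: z_def)
    then have "0 \<in> T a" "1 \<in> T b" using x y a b A(1) N(2) T[of a 0] T[of b 1] by auto
    then show "0 \<in> ?U" "1 \<in> ?V" using a b by blast+
  qed
  moreover have "connected {0..1::real}" by simp
  ultimately have "?U \<inter> ?V \<inter> {0..1} \<noteq> {}"
    unfolding connected_closed by (metis IntI atLeastAtMost_iff empty_iff order_refl zero_le_one)
  then obtain t v w where "v \<in> A" "w \<in> ?N - A" "t \<in> T v" "t \<in> T w" by blast
  then have "z t \<in> region n P f v \<inter> region n P f w" "v \<in> verts n" "w \<in> verts n" "v \<noteq> w"
    using T A(1) N(2) by blast+
  then have "{v, w} \<in> edges n P f" unfolding edges_def by blast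
  then show ?thesis using \<open>v \<in> A\<close> \<open>w \<in> ?N - A\<close> by blast
qed

text \<open>Grows a vertex set from a single vertex. An edge leaving the set brings in one new
  vertex and is itself not inside the old set, so the number of inner edges keeps up with the number
  of added vertices.\<close>

lemma card_le_edges:
  assumes "finite N" "finite Es"
    and cut: "\<And>A. A \<subseteq> N \<Longrightarrow> A \<noteq> {} \<Longrightarrow> A \<noteq> N \<Longrightarrow> \<exists>a\<in>A. \<exists>b\<in>N - A. {a, b} \<in> Es"
  shows "card N \<le> card Es + 1"
proof (cases "N = {}")
  case False
  then obtain a where a: "a \<in> N" by blast
  have "\<exists>A\<subseteq>N. card A = Suc k \<and> k \<le> card {e\<in>Es. e \<subseteq> A}" if "k < card N" for k
    using that
  proof (induction k)
    case 0
    then show ?case using a by (intro exI[of _ "{a}"]) auto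
  next
    case (Suc k)
    then obtain A where A: "A \<subseteq> N" "card A = Suc k" "k \<le> card {e\<in>Es. e \<subseteq> A}" by auto
    have "A \<noteq> {}" "A \<noteq> N" using A Suc.prems by auto
    then obtain u v where uv: "u \<in> A" "v \<in> N - A" "{u, v} \<in> Es" using cut[OF A(1)] by blast
    have "finite A" using A(1) assms(1) by (rule finite_subset)
    have "insert {u, v} {e\<in>Es. e \<subseteq> A} \<subseteq> {e\<in>Es. e \<subseteq> insert v A}" using uv by auto
    then have "card (insert {u, v} {e\<in>Es. e \<subseteq> A}) \<le> card {e\<in>Es. e \<subseteq> insert v A}"
      using assms(2) by (intro card_mono) auto
    moreover have "card (insert {u, v} {e\<in>Es. e \<subseteq> A}) = Suc (card {e\<in>Es. e \<subseteq> A})"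
      using assms(2) uv by (intro card_insert_disjoint) auto
    ultimately show ?case
      using A uv \<open>finite A\<close> by (intro exI[of _ "insert v A"]) auto
  qed
  from this[of "card N - 1"] obtain A where "A \<subseteq> N" "card N - 1 \<le> card {e\<in>Es. e \<subseteq> A}"
    using False assms(1) by (auto simp: card_gt_0_iff)
  moreover have "card {e\<in>Es. e \<subseteq> A} \<le> card Es" using assms(2) by (intro card_mono) auto
  ultimately show ?thesis by linarith
qed simp

lemma pair_value_affine:
  "pair_value env (\<lambda>k. (1 - t) * x k + t * y k) v = (1 - t) * pair_value env x v + t * pair_value env y v"
proof -
  have "(\<Sum>k<dim env. coef env v k * ((1 - t) * x k + t * y k)) =
      (1 - t) * (\<Sum>k<dim env. coef env v k * x k) + t * (\<Sum>k<dim env. coef env v k * y k)"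
    unfolding sum_distrib_left sum.distrib[symmetric] by (intro sum.cong) (auto simp: algebra_simps)
  then show ?thesis by (simp add: pair_value_def algebra_simps)
qed

section \<open>Symmetry, and assembly of the theorem\<close>

lemma interp_commute:
  assumes "\<forall>i<l. merge_function X (D i)" "\<forall>j<m. Metric_space X (\<delta> j)"
    and "A \<subseteq> X" "B \<subseteq> X" "finite A" "finite B" "A \<noteq> {}" "B \<noteq> {}"
  shows "interp l m D \<delta> \<rho> A B = interp l m D \<delta> \<rho> B A"
proof -
  have "D i A B (\<delta> j) = D i B A (\<delta> j)" if "i < l" "j < m" for i j
    using assms that unfolding merge_function_def by blast
  then show ?thesis unfolding interp_def by (intro sum.cong) auto
qed

text \<open>Regions compete against all ordered pairs of distinct clusters; by symmetry each such
  pair can be sorted into \<open>verts n\<close>.\<close>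

lemma region_verts:
  assumes "v \<in> verts n" and f: "\<And>\<rho> i j. f \<rho> i j = g \<rho> (i, j)"
    and sym: "\<And>\<rho> i j. i < n \<Longrightarrow> j < n \<Longrightarrow> f \<rho> i j = f \<rho> j i"
  shows "region n P f v = {\<rho>\<in>P. \<forall>u\<in>verts n. g \<rho> v \<le> g \<rho> u}"
proof -
  have "(\<forall>i'<n. \<forall>j'<n. i' \<noteq> j' \<longrightarrow> c \<le> f \<rho> i' j') \<longleftrightarrow> (\<forall>u\<in>verts n. c \<le> g \<rho> u)" for c \<rho>
  proof
    assume R: "\<forall>u\<in>verts n. c \<le> g \<rho> u"
    show "\<forall>i'<n. \<forall>j'<n. i' \<noteq> j' \<longrightarrow> c \<le> f \<rho> i' j'"
    proof (intro allI impI)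
      fix i j assume ij: "i < n" "j < n" "i \<noteq> j"
      have "c \<le> f \<rho> (min i j) (max i j)" unfolding f
        using R ij by (auto simp: verts_def)
      then show "c \<le> f \<rho> i j" using sym[OF ij(1,2), of \<rho>] by (auto simp: min_def max_def split: if_splits)
    qed
  qed (auto simp: verts_def f[symmetric])
  then show ?thesis by (cases v) (simp add: region_def f)
qed

theorem theorem2:
  shows "\<exists>(prog :: com) (c :: nat).
    \<forall>(X :: 'x set) (S :: 'x set) (l :: nat) (m :: nat) (d :: nat)
      (D :: nat \<Rightarrow> 'x merge_fun) (\<delta> :: nat \<Rightarrow> 'x metric)
      (P :: (nat \<Rightarrow> real) set) (n :: nat) (C :: nat \<Rightarrow> 'x set) (\<rho>\<^sub>0 :: nat \<Rightarrow> real)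
      (\<kappa> :: nat \<Rightarrow> nat \<Rightarrow> nat \<Rightarrow> nat) (K :: nat) (lp :: solver) (LP :: nat \<Rightarrow> nat \<Rightarrow> nat)
      (f :: (nat \<Rightarrow> real) \<Rightarrow> nat \<Rightarrow> nat \<Rightarrow> real) (E :: nat) (V :: nat).
      finite S \<and> S \<noteq> {} \<and> S \<subseteq> X \<and>
      1 \<le> l \<and> 1 \<le> m \<and> d = l * m - 1 \<and>
      (\<forall>i<l. merge_function X (D i)) \<and> (\<forall>j<m. Metric_space X (\<delta> j)) \<and>
      convex_polytope d P \<and> P \<subseteq> std_simplex d \<and>
      \<rho>\<^sub>0 \<in> std_simplex d \<and> linkage_stage (interp l m D \<delta> \<rho>\<^sub>0) S (C ` {..<n}) \<and> inj_on C {..<n} \<and>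
      f = (\<lambda>\<rho> i j. interp l m D \<delta> \<rho> (C i) (C j)) \<and>
      card (edges n P f) = E \<and> card (nonempty_verts n P f) = V \<and>
      (\<forall>(i, j)\<in>verts n. merge_time (l * m) \<kappa> i j \<le> K) \<and>
      lp_solver d P lp \<and> lp_cost_function LP
      \<longrightarrow>
      (\<exists>t s. exec (linkage_env l m D \<delta> C \<kappa> lp LP) prog (init_state n d) t s \<and>
             result s = nonempty_verts n P f \<and>
             t \<le> c * (n\<^sup>2 * LP d E + V * n\<^sup>2 * K))"
proof (rule exI[of _ find_vertices], rule exI[of _ 200], intro allI impI, elim conjE)
  fix X S :: "'x set" and l m d :: nat and D :: "nat \<Rightarrow> 'x merge_fun" and \<delta> :: "nat \<Rightarrow> 'x metric"
    and P :: "(nat \<Rightarrow> real) set" and n :: nat and C :: "nat \<Rightarrow> 'x set" and \<rho>\<^sub>0 :: "nat \<Rightarrow> real"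
    and \<kappa> :: "nat \<Rightarrow> nat \<Rightarrow> nat \<Rightarrow> nat" and K :: nat and lp :: solver and LP :: "nat \<Rightarrow> nat \<Rightarrow> nat"
    and f :: "(nat \<Rightarrow> real) \<Rightarrow> nat \<Rightarrow> nat \<Rightarrow> real" and E V :: nat
  assume S: "finite S" "S \<noteq> {}" "S \<subseteq> X" and lm: "1 \<le> l" "1 \<le> m" and d: "d = l * m - 1"
    and D: "\<forall>i<l. merge_function X (D i)" and \<delta>: "\<forall>j<m. Metric_space X (\<delta> j)"
    and P: "convex_polytope d P"
    and stage: "linkage_stage (interp l m D \<delta> \<rho>\<^sub>0) S (C ` {..<n})"
    and f: "f = (\<lambda>\<rho> i j. interp l m D \<delta> \<rho> (C i) (C j))"
    and E: "card (edges n P f) = E" and V: "card (nonempty_verts n P f) = V"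
    and K: "\<forall>(i, j)\<in>verts n. merge_time (l * m) \<kappa> i j \<le> K"
    and lp: "lp_solver d P lp" and LP: "lp_cost_function LP"
  let ?env = "linkage_env l m D \<delta> C \<kappa> lp LP"
  have env: "dim ?env = d" "solve ?env = lp" "solve_cost ?env = LP" "base_cost ?env = \<kappa>" "l * m = d + 1"
    using lm d by (auto simp: linkage_env_def)
  have clusters: "C ` {..<n} \<noteq> {}" "\<And>i. i < n \<Longrightarrow> C i \<noteq> {} \<and> C i \<subseteq> S"
    using linkage_stage_clusters[OF stage S(2)] by auto
  have n: "1 \<le> n" using clusters(1) by (cases n) auto
  have val: "f \<rho> i j = pair_value ?env \<rho> (i, j)" for \<rho> i j
    unfolding f by (rule interp_eq_pair_value[OF lm])
  have sym: "f \<rho> i j = f \<rho> j i" if "i < n" "j < n" for \<rho> i j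
    unfolding f using clusters(2)[OF that(1)] clusters(2)[OF that(2)] S(1,3)
    by (intro interp_commute[OF D \<delta>]) (auto intro: finite_subset)
  have region: "region n P f v = {\<rho>\<in>P. \<forall>u\<in>verts n. pair_value ?env \<rho> v \<le> pair_value ?env \<rho> u}"
    if "v \<in> verts n" for v
    using that val sym by (rule region_verts)
  have N: "nonempty_verts n P f = attained ?env n P"
  proof -
    have "region n P f v \<noteq> {} \<longleftrightarrow> (\<exists>\<rho>\<in>P. \<forall>u\<in>verts n. pair_value ?env \<rho> v \<le> pair_value ?env \<rho> u)"
      if "v \<in> verts n" for v
      unfolding region[OF that] by blast
    then show ?thesis unfolding nonempty_verts_def attained_def by (intro Collect_cong) blast
  qed
  have "finite (nonempty_verts n P f)"
    using card_verts(1) by (simp add: nonempty_verts_def)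
  then have VE: "card (nonempty_verts n P f) \<le> card (edges n P f) + 1"
    by (rule card_le_edges[OF _ finite_edges edge_across_cut[OF P pair_value_affine region]])
  have "runs ?env find_vertices (init_state n (dim ?env)) (\<lambda>t s. result s = attained ?env n P \<and>
      t \<le> 200 * (n\<^sup>2 * solve_cost ?env (dim ?env) E + card (attained ?env n P) * n\<^sup>2 * K))"
  proof (rule runs_find_vertices[OF n])
    show "lp_solver (dim ?env) P (solve ?env)" "lp_cost_function (solve_cost ?env)" using lp LP env by auto
    show "card (attained ?env n P) \<le> E + 1" using VE N E by simp
    fix i j assume "i < j" "j < n"
    then have "(i, j) \<in> verts n" by (simp add: verts_def)
    then show "(\<Sum>k<dim ?env + 1. base_cost ?env k i j + 2) \<le> K"
      using K unfolding merge_time_def env by blast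
  qed
  then show "\<exists>t s. exec ?env find_vertices (init_state n d) t s \<and> result s = nonempty_verts n P f \<and>
      t \<le> 200 * (n\<^sup>2 * LP d E + V * n\<^sup>2 * K)"
    unfolding runs_def env N[symmetric] V .
qed

end
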